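(* Fix an algebraic closure $\overline{\mathbb{Q}}$ and let $F\subset\overline{\mathbb{Q}}$ be any quadratic extension of $\mathbb{Q}(\sqrt{2})$. Then every $F$-rational point on the Fermat quartic $x^4+y^4=z^4$ is defined over one of the fields $\mathbb{Q}(\sqrt{2},i)$, $\mathbb{Q}(\sqrt{2},\sqrt{-7})$, $\mathbb{Q}(\sqrt[4]{2})$ or $\mathbb{Q}(\sqrt[4]{2}\,i)$. *)

theory Defs
  imports "HOL-Algebra.Algebraic_Closure_Type" "HOL-Algebra.Generated_Fields"
begin

text \<open>The field \<open>\<rat>(S)\<close>. In characteristic zero, the subfield generated by \<open>S\<close> contains the
  prime field \<open>\<rat>\<close>.\<close>

definition Q_adjoin :: "'a::field_char_0 set \<Rightarrow> 'a set" where
  "Q_adjoin S = generate_field ring_of_type_algebra S"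

definition quadratic_extension :: "'a::field set \<Rightarrow> 'a set \<Rightarrow> bool" where
  "quadratic_extension K F \<longleftrightarrow>
     subfield K ring_of_type_algebra \<and> subfield F ring_of_type_algebra \<and> K \<subseteq> F \<and>
     ring.dimension ring_of_type_algebra 2 K F"

text \<open>The point \<open>[x : y : z]\<close> of the projective plane over the ambient field, as the class of its
  homogeneous coordinates. It is a point only for \<open>(x, y, z) \<noteq> (0, 0, 0)\<close>.\<close>

definition proj_point :: "'a::field \<Rightarrow> 'a \<Rightarrow> 'a \<Rightarrow> ('a \<times> 'a \<times> 'a) set" where
  "proj_point x y z = {(c * x, c * y, c * z) | c. c \<noteq> 0}"

text \<open>The \<open>K\<close>-rational points of the projective plane curve \<open>x\<^sup>4 + y\<^sup>4 = z\<^sup>4\<close>. Scaling ranges over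
  the ambient field, so the point sets for different subfields \<open>K\<close> are comparable, and a point is
  defined over \<open>K\<close> iff some choice of its homogeneous coordinates lies in \<open>K\<close>.\<close>

definition fermat_quartic_points :: "'a::field set \<Rightarrow> ('a \<times> 'a \<times> 'a) set set" where
  "fermat_quartic_points K =
     {proj_point x y z | x y z. x \<in> K \<and> y \<in> K \<and> z \<in> K \<and> (x, y, z) \<noteq> (0, 0, 0) \<and>
        x ^ 4 + y ^ 4 = z ^ 4}"

end

theory Submission
  imports Defs "HOL-Computational_Algebra.Nth_Powers" Complex_Main
begin

text \<open>
  Let \<open>K = \<rat>(\<surd>2)\<close>. A point with \<open>xyz \<noteq> 0\<close> gives the parameter \<open>t = y\<^sup>2 / (z\<^sup>2 + x\<^sup>2)\<close> of the conic
  \<open>X\<^sup>2 + Y\<^sup>2 = Z\<^sup>2\<close>, and both \<open>2t(1 + t\<^sup>2)\<close> and \<open>2t(1 - t\<^sup>2)\<close> are squares in \<open>F\<close>. The elliptic curves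
  \<open>w\<^sup>2 = 2t(1 \<plusminus> t\<^sup>2)\<close> have only finitely many points over \<open>K\<close>: the same argument as below, one level down,
  reduces this to rational points, and 2-isogenies and Fermat's descent find those.

  If \<open>t\<close> is not in \<open>K\<close>, the line through the point over \<open>t\<close> and its conjugate meets each of the two curves
  in a third point over \<open>K\<close>, so its abscissa is one of finitely many values. Together the two values determine
  trace and norm of \<open>t\<close>, and only \<open>t\<^sup>2 + t + 2 = 0\<close> survives, whence \<open>F = K(\<surd>-7)\<close>.
  If \<open>t\<close> is in \<open>K\<close>, then one of \<open>2t(1 + t\<^sup>2)\<close>, \<open>2t(1 - t\<^sup>2)\<close>, \<open>1 - t\<^sup>4\<close> is a square in \<open>K\<close>; this
  forces \<open>t = -1 \<plusminus> \<surd>2\<close>, which gives \<open>x\<^sup>2 = y\<^sup>2\<close> and \<open>z\<^sup>2 = \<plusminus>\<surd>2 x\<^sup>2\<close>.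
\<close>

subsection \<open>Fermat descent\<close>

lemma coprime_square_prodE:
  fixes u v w :: nat
  assumes "u * v = w\<^sup>2" "coprime u v"
  obtains a b where "u = a\<^sup>2" "v = b\<^sup>2" "coprime a b" "w = a * b"
proof -
  have "is_nth_power 2 (u * v)"
    using assms(1) by (auto intro: is_nth_powerI)
  then obtain a b where ab: "u = a\<^sup>2" "v = b\<^sup>2"
    using is_nth_power_mult_coprime_nat_iff[OF assms(2), of 2] by (auto elim!: is_nth_powerE)
  have "coprime a b"
    using assms(2) ab by simp
  moreover have "w\<^sup>2 = (a * b)\<^sup>2"
    using assms(1) ab by (simp add: power_mult_distrib)
  then have "w = a * b"
    by (simp add: power2_eq_iff_nonneg)
  ultimately show thesis
    using that ab by blast
qed

lemma square_mod_4_odd: "odd (x::nat) \<Longrightarrow> x\<^sup>2 mod 4 = 1"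
proof (elim oddE)
  fix b assume "x = 2 * b + 1"
  then have "x\<^sup>2 = 4 * (b\<^sup>2 + b) + 1" by (simp add: power2_eq_square algebra_simps)
  then show ?thesis by presburger
qed

lemma even_square_mod_4: "even (x::nat) \<Longrightarrow> x\<^sup>2 mod 4 = 0"
  by (elim evenE) (simp add: power2_eq_square algebra_simps)

lemma sum_squares_odd_even:
  fixes x y z :: nat
  assumes "x\<^sup>2 + y\<^sup>2 = z\<^sup>2" "odd x"
  shows "even y" "odd z"
proof -
  have "(x\<^sup>2 mod 4 + y\<^sup>2 mod 4) mod 4 = z\<^sup>2 mod 4"
    using assms(1) by (simp add: mod_add_eq)
  then show "even y" "odd z"
    using square_mod_4_odd[of x] square_mod_4_odd[of y] square_mod_4_odd[of z]
      even_square_mod_4[of y] even_square_mod_4[of z] assms(2)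
    by (cases "even y"; cases "even z"; simp)+
qed

lemma coprime_sum_squares_iff:
  fixes x y z :: nat
  assumes "x\<^sup>2 + y\<^sup>2 = z\<^sup>2"
  shows "coprime x y \<longleftrightarrow> coprime y z"
proof -
  have "gcd (z\<^sup>2) (y\<^sup>2) = gcd (x\<^sup>2) (y\<^sup>2)"
    using assms by (metis gcd_add1)
  then have "coprime (x\<^sup>2) (y\<^sup>2) \<longleftrightarrow> coprime (z\<^sup>2) (y\<^sup>2)"
    by (simp add: coprime_iff_gcd_eq_1)
  then show ?thesis
    by (simp add: coprime_commute)
qed

text \<open>With \<open>v = (z - x) / 2\<close>, the coprime numbers \<open>x + v\<close> and
  \<open>v\<close> multiply to \<open>(y / 2)^2\<close>, so each is a square. The first equation is
  written as a sum to avoid truncated subtraction.\<close>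

lemma pythagorean_tripleE:
  fixes x y z :: nat
  assumes xyz: "x\<^sup>2 + y\<^sup>2 = z\<^sup>2" and "coprime x y" and "odd x"
  obtains a b where "x + b\<^sup>2 = a\<^sup>2" "y = 2 * a * b" "z = a\<^sup>2 + b\<^sup>2" "coprime a b"
proof -
  have "even y" "odd z"
    using sum_squares_odd_even[OF xyz \<open>odd x\<close>] by auto
  have "x \<le> z"
    using xyz by (metis le_add1 power2_nat_le_eq_le)
  then have "even (z - x)"
    using \<open>odd x\<close> \<open>odd z\<close> by simp
  then obtain v where "z - x = 2 * v" by (elim evenE)
  then have z: "z = x + 2 * v" using \<open>x \<le> z\<close> by simp
  obtain w where w: "y = 2 * w" using \<open>even y\<close> by (elim evenE)
  have uv: "(x + v) * v = w\<^sup>2"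
    using xyz by (simp add: z w power2_eq_square algebra_simps)
  have "coprime w x"
    using \<open>coprime x y\<close> w by (simp add: coprime_commute)
  have "coprime (x + v) v"
  proof (rule coprimeI)
    fix c assume c: "c dvd x + v" "c dvd v"
    then have "c dvd x" by (simp add: dvd_add_left_iff)
    moreover have "c dvd w\<^sup>2" using c uv by (metis dvd_mult)
    moreover have "coprime (w\<^sup>2) x" using \<open>coprime w x\<close> by simp
    ultimately show "is_unit c" using coprime_common_divisor by blast
  qed
  then obtain a b where ab: "x + v = a\<^sup>2" "v = b\<^sup>2" "coprime a b" "w = a * b"
    using coprime_square_prodE[OF uv] by blast
  then show thesis
    by (intro that[of b a]) (auto simp: z w)
qed

text \<open>Simultaneous infinite descent: parametrizing the Pythagorean triple behind a solution of
  either equation yields a solution of the other. The single measure \<open>N\<close> is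
  \<open>v\<close> for the first equation and \<open>p^2\<close> for the second, so the steps go
  from \<open>N\<close> to \<open>c^2 < N\<close> and from \<open>p^2\<close> to
  \<open>p\<close>.\<close>

lemma quartic_descent_sum:
  fixes N :: nat
  shows "(\<forall>p q v. coprime p q \<and> p > 0 \<and> q > 0 \<and> v = N \<longrightarrow> p ^ 4 + q ^ 4 \<noteq> v\<^sup>2) \<and>
         (\<forall>p q v. coprime p q \<and> q > 0 \<and> p\<^sup>2 = N \<longrightarrow> p ^ 4 \<noteq> 4 * q ^ 4 + v\<^sup>2)"
proof (induction N rule: less_induct)
  case (less N)
  have A: False if pq: "coprime p q" "p > 0" "q > 0" "odd p" "p ^ 4 + q ^ 4 = N\<^sup>2" for p q
  proof -
    have "(p\<^sup>2)\<^sup>2 + (q\<^sup>2)\<^sup>2 = N\<^sup>2" using pq by simp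
    moreover have "coprime (p\<^sup>2) (q\<^sup>2)" "odd (p\<^sup>2)" using pq by auto
    ultimately obtain a b where ab: "p\<^sup>2 + b\<^sup>2 = a\<^sup>2" "q\<^sup>2 = 2 * a * b" "N = a\<^sup>2 + b\<^sup>2" "coprime a b"
      by (rule pythagorean_tripleE)
    have "even b" using sum_squares_odd_even[OF ab(1)] pq by simp
    then obtain b' where b': "b = 2 * b'" by (elim evenE)
    have "even (q\<^sup>2)" using ab(2) by simp
    then obtain q' where q': "q = 2 * q'" by auto
    have "a * b' = q'\<^sup>2" using ab(2) by (simp add: q' b' power2_eq_square)
    moreover have "coprime a b'" using ab(4) b' by simp
    ultimately obtain c d where cd: "a = c\<^sup>2" "b' = d\<^sup>2" "coprime c d" "q' = c * d"
      by (rule coprime_square_prodE)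
    have "d > 0" "b > 0" using pq(3) q' cd b' by auto
    then have "a > 0" using ab(1) by (cases a) auto
    have "a < N"
    proof -
      have "a \<le> a\<^sup>2" by (simp add: power2_eq_square)
      then show ?thesis using ab(3) \<open>b > 0\<close> by (simp add: add_strict_increasing2 le_add1 trans_less_add1 order_le_less_trans)
    qed
    moreover have "c ^ 4 = 4 * d ^ 4 + p\<^sup>2"
      using ab(1) by (simp add: cd b' power_mult_distrib)
    ultimately show False
      using less.IH[of "c\<^sup>2"] cd \<open>d > 0\<close> by blast
  qed
  have B: "p ^ 4 + q ^ 4 \<noteq> N\<^sup>2" if pq: "coprime p q" "p > 0" "q > 0" for p q
  proof
    assume eq: "p ^ 4 + q ^ 4 = N\<^sup>2"
    have "odd p \<or> odd q" using pq by auto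
    then show False
      using A[of p q] A[of q p] pq eq by (auto simp: coprime_commute add.commute)
  qed
  have C: "p ^ 4 \<noteq> 4 * q ^ 4 + v\<^sup>2" if pq: "coprime p q" "q > 0" "p\<^sup>2 = N" for p q v
  proof
    assume eq: "p ^ 4 = 4 * q ^ 4 + v\<^sup>2"
    have sq: "v\<^sup>2 + (2 * q\<^sup>2)\<^sup>2 = (p\<^sup>2)\<^sup>2"
      using eq by (simp add: power_mult_distrib)
    show False
    proof (cases "odd v")
      case True
      have "odd p" using sum_squares_odd_even(2)[OF sq True] by simp
      then have "coprime (2 * q\<^sup>2) (p\<^sup>2)" using pq(1) by (simp add: coprime_commute)
      then have "coprime v (2 * q\<^sup>2)" using coprime_sum_squares_iff[OF sq] by simp
      then obtain a b where ab: "2 * q\<^sup>2 = 2 * a * b" "p\<^sup>2 = a\<^sup>2 + b\<^sup>2" "coprime a b"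
        using pythagorean_tripleE[OF sq _ True] by metis
      have "a * b = q\<^sup>2" using ab by simp
      then obtain c d where cd: "a = c\<^sup>2" "b = d\<^sup>2" "coprime c d" "q = c * d"
        using ab(3) by (rule coprime_square_prodE)
      have pos: "c > 0" "d > 0" using pq(2) cd by auto
      have eq': "c ^ 4 + d ^ 4 = p\<^sup>2" using ab(2) by (simp add: cd)
      have "c ^ 4 \<ge> 1" "d ^ 4 \<ge> 1" using pos by simp_all
      then have "p\<^sup>2 \<ge> 2" using eq' by linarith
      then have "p > 1" by (cases "p = 0"; cases "p = 1") auto
      then have "p < p\<^sup>2" by (simp add: power2_eq_square)
      then show False
        using less.IH[of p] pq(3) cd pos eq' by blast
    next
      \<comment> \<open>Here \<open>p\<close> and \<open>v\<close> are even and \<open>q\<close> is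
        odd. Cancelling 4 leaves an odd square plus a square equal to an even square, which is
        impossible modulo 4.\<close>
      case False
      have "even (p ^ 4)" using False eq by simp
      then have "even p" by simp
      then have "odd q" using pq(1) by auto
      obtain p' where p': "p = 2 * p'" using \<open>even p\<close> by (elim evenE)
      obtain v' where v': "v = 2 * v'" using False by (auto elim: evenE)
      have "4 * p' ^ 4 = q ^ 4 + v'\<^sup>2" using eq by (simp add: p' v' power_mult_distrib)
      then have eq': "(q\<^sup>2)\<^sup>2 + v'\<^sup>2 = (2 * p'\<^sup>2)\<^sup>2" by (simp add: power_mult_distrib)
      show False
        using sum_squares_odd_even(2)[OF eq'] \<open>odd q\<close> by simp
    qed
  qed
  show ?case using B C by blast
qed

lemma fourth_powers_sum_not_square:
  fixes p q v :: nat
  assumes "coprime p q" "p > 0" "q > 0"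
  shows "p ^ 4 + q ^ 4 \<noteq> v\<^sup>2"
  using quartic_descent_sum assms by blast

lemma fourth_power_minus_4_not_square:
  fixes p q v :: nat
  assumes "coprime p q" "q > 0"
  shows "p ^ 4 \<noteq> 4 * q ^ 4 + v\<^sup>2"
  using quartic_descent_sum assms by blast

text \<open>The same alternation between two equations, with the sign of the term
  \<open>4 * q ^ 4\<close> changed. Each equation also has a parity case that descends to a smaller
  solution of itself. Positivity of \<open>v\<close> in the second part excludes the solution
  \<open>p = q = 1\<close>.\<close>

lemma quartic_descent_diff:
  fixes N :: nat
  shows "(\<forall>p q v. coprime p q \<and> p > 0 \<and> q > 0 \<and> v = N \<longrightarrow> p ^ 4 + 4 * q ^ 4 \<noteq> v\<^sup>2) \<and>
         (\<forall>p q v. coprime p q \<and> q > 0 \<and> v > 0 \<and> p\<^sup>2 = N \<longrightarrow> p ^ 4 \<noteq> q ^ 4 + v\<^sup>2)"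
proof (induction N rule: less_induct)
  case (less N)
  have A: "p ^ 4 + 4 * q ^ 4 \<noteq> N\<^sup>2" if pq: "coprime p q" "p > 0" "q > 0" for p q
  proof
    assume eq: "p ^ 4 + 4 * q ^ 4 = N\<^sup>2"
    show False
    proof (cases "odd p")
      case True
      have sq: "(p\<^sup>2)\<^sup>2 + (2 * q\<^sup>2)\<^sup>2 = N\<^sup>2" using eq by (simp add: power_mult_distrib)
      moreover have "coprime (p\<^sup>2) (2 * q\<^sup>2)" "odd (p\<^sup>2)" using pq True by auto
      ultimately obtain a b where ab: "p\<^sup>2 + b\<^sup>2 = a\<^sup>2" "2 * q\<^sup>2 = 2 * a * b" "N = a\<^sup>2 + b\<^sup>2" "coprime a b"
        by (rule pythagorean_tripleE)
      have "a * b = q\<^sup>2" using ab by simp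
      then obtain c d where cd: "a = c\<^sup>2" "b = d\<^sup>2" "coprime c d" "q = c * d"
        using ab(4) by (rule coprime_square_prodE)
      have pos: "c > 0" "d > 0" "b > 0" using pq(3) cd by auto
      have "a \<le> a\<^sup>2" by (simp add: power2_eq_square)
      then have "c\<^sup>2 < N" using ab(3) pos cd by (metis add_less_cancel_left less_add_same_cancel1 order_le_less_trans zero_less_power)
      moreover have "c ^ 4 = d ^ 4 + p\<^sup>2" using ab(1) by (simp add: cd)
      ultimately show False
        using less.IH[of "c\<^sup>2"] cd pos pq(2) by blast
    next
      case False
      \<comment> \<open>Cancelling 4 exchanges the roles of the two fourth powers and halves
        \<open>N\<close>.\<close>
      then obtain p' where p': "p = 2 * p'" by (auto elim: evenE)
      have "even (N\<^sup>2)" using eq False by (metis dvd_add even_mult_iff even_numeral even_power zero_less_numeral)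
      then obtain N' where N': "N = 2 * N'" by (auto elim: evenE)
      have "q ^ 4 + 4 * p' ^ 4 = N'\<^sup>2" using eq by (simp add: p' N' power_mult_distrib)
      moreover have "N' < N"
        using N' eq pq by (cases N') auto
      moreover have "coprime q p'" "p' > 0" using pq p' by (auto simp: coprime_commute)
      ultimately show False
        using less.IH[of N'] pq(3) by blast
    qed
  qed
  have B: "p ^ 4 \<noteq> q ^ 4 + v\<^sup>2" if pq: "coprime p q" "q > 0" "v > 0" "p\<^sup>2 = N" for p q v
  proof
    assume eq: "p ^ 4 = q ^ 4 + v\<^sup>2"
    have "p ^ 4 \<ge> 2"
    proof -
      have "q ^ 4 \<ge> 1" "v\<^sup>2 \<ge> 1" using pq by simp_all
      then show ?thesis using eq by linarith
    qed
    then have "p > 1" by (cases "p = 0"; cases "p = 1") auto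
    then have "p < p\<^sup>2" by (simp add: power2_eq_square)
    show False
    proof (cases "odd v")
      case True
      have sq: "v\<^sup>2 + (q\<^sup>2)\<^sup>2 = (p\<^sup>2)\<^sup>2" using eq by simp
      have "coprime (q\<^sup>2) (p\<^sup>2)" using pq(1) by (simp add: coprime_commute)
      then have "coprime v (q\<^sup>2)" using coprime_sum_squares_iff[OF sq] by simp
      then obtain a b where ab: "q\<^sup>2 = 2 * a * b" "p\<^sup>2 = a\<^sup>2 + b\<^sup>2" "coprime a b"
        using pythagorean_tripleE[OF sq _ True] by metis
      have "even (q\<^sup>2)" using ab(1) by simp
      then obtain q' where q': "q = 2 * q'" by auto
      have *: "a * b = 2 * q'\<^sup>2" using ab(1) by (simp add: q' power2_eq_square)
      \<comment> \<open>One of \<open>a\<close> and \<open>b\<close> is even since their product is;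
        \<open>key\<close> is stated for a generic pair so that it serves both
        possibilities.\<close>
      have key: False if xy: "x * (2 * y) = 2 * q'\<^sup>2" "p\<^sup>2 = x\<^sup>2 + (2 * y)\<^sup>2" "coprime x (2 * y)" for x y
      proof -
        have "x * y = q'\<^sup>2" "coprime x y" using xy by auto
        then obtain c d where cd: "x = c\<^sup>2" "y = d\<^sup>2" "coprime c d" "q' = c * d"
          by (rule coprime_square_prodE)
        have pos: "c > 0" "d > 0" using pq(2) q' cd by auto
        have "c ^ 4 + 4 * d ^ 4 = p\<^sup>2" using xy(2) by (simp add: cd power_mult_distrib)
        then show False
          using less.IH[of p] \<open>p < p\<^sup>2\<close> pq(4) cd pos by blast
      qed
      have "even (a * b)" using * by simp
      then consider y where "b = 2 * y" | y where "a = 2 * y"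
        by (auto elim: evenE)
      then show False
      proof cases
        case 1
        then show False using key[of a y] * ab by auto
      next
        case 2
        then show False using key[of b y] * ab by (auto simp: coprime_commute mult.commute)
      qed
    next
      case False
      have "odd q"
      proof
        assume "even q"
        then have "even (p ^ 4)" using eq False by simp
        then show False using pq(1) \<open>even q\<close> by auto
      qed
      have sq: "(q\<^sup>2)\<^sup>2 + v\<^sup>2 = (p\<^sup>2)\<^sup>2" using eq by simp
      have "coprime (q\<^sup>2) (p\<^sup>2)" using pq(1) by (simp add: coprime_commute)
      then have "coprime v (q\<^sup>2)" using coprime_sum_squares_iff[of v "q\<^sup>2" "p\<^sup>2"] sq by (simp add: add.commute)
      then have "coprime (q\<^sup>2) v" by (simp add: coprime_commute)
      moreover have "odd (q\<^sup>2)" using \<open>odd q\<close> by simp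
      ultimately obtain a b where ab: "q\<^sup>2 + b\<^sup>2 = a\<^sup>2" "v = 2 * a * b" "p\<^sup>2 = a\<^sup>2 + b\<^sup>2" "coprime a b"
        by (rule pythagorean_tripleE[OF sq])
      have pos: "a > 0" "b > 0" using ab(2) pq(3) by auto
      \<comment> \<open>The product of \<open>a^2 - b^2 = q^2\<close> and
        \<open>a^2 + b^2 = p^2\<close> is again a difference of fourth powers that is a
        square.\<close>
      have "a ^ 4 = b ^ 4 + (p * q)\<^sup>2"
      proof -
        have "(p * q)\<^sup>2 = (a\<^sup>2 + b\<^sup>2) * q\<^sup>2" using ab(3) by (simp add: power_mult_distrib)
        then have "(p * q)\<^sup>2 + b ^ 4 = a\<^sup>2 * q\<^sup>2 + b\<^sup>2 * (q\<^sup>2 + b\<^sup>2)"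
          by (simp add: algebra_simps flip: power_add)
        also have "\<dots> = a\<^sup>2 * (q\<^sup>2 + b\<^sup>2)"
          by (metis ab(1) distrib_left mult.commute)
        also have "\<dots> = a ^ 4" by (simp add: ab(1) flip: power_add)
        finally show ?thesis by simp
      qed
      moreover have "a\<^sup>2 < N" using ab(3) pos pq(4) by simp
      moreover have "p * q > 0" using pq \<open>p > 1\<close> by simp
      ultimately show False
        using less.IH[of "a\<^sup>2"] ab(4) pos by blast
    qed
  qed
  show ?case using A B by blast
qed

lemma fourth_power_plus_4_not_square:
  fixes p q v :: nat
  assumes "coprime p q" "p > 0" "q > 0"
  shows "p ^ 4 + 4 * q ^ 4 \<noteq> v\<^sup>2"
  using quartic_descent_diff assms by blast

lemma fourth_powers_diff_not_square:
  fixes p q v :: nat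
  assumes "coprime p q" "q > 0" "v > 0"
  shows "p ^ 4 \<noteq> q ^ 4 + v\<^sup>2"
  using quartic_descent_diff assms by blast

subsection \<open>Rational points\<close>

text \<open>The integers are integrally closed: in lowest terms the squared denominator divides the
  squared numerator, so the denominator is a unit.\<close>

lemma rat_square_is_int:
  fixes x :: rat
  assumes "x\<^sup>2 = of_int n"
  obtains a where "x = of_int a"
proof -
  obtain a b where ab: "quotient_of x = (a, b)" by fastforce
  have x: "x = of_int a / of_int b" and "b > 0" and "coprime a b"
    using quotient_of_div[OF ab] quotient_of_denom_pos[OF ab] quotient_of_coprime[OF ab] by auto
  have "(of_int (a\<^sup>2) :: rat) = of_int (n * b\<^sup>2)"
    using assms \<open>b > 0\<close> by (simp add: x field_simps)
  then have "a\<^sup>2 = n * b\<^sup>2"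
    by (simp only: of_int_eq_iff)
  then have "b\<^sup>2 dvd a\<^sup>2" by simp
  then have "b dvd a" by simp
  then have "is_unit b" using \<open>coprime a b\<close> by (metis coprime_common_divisor dvd_refl)
  then have "b = 1" using \<open>b > 0\<close> by simp
  then show thesis using that x by simp
qed

lemma rat_square_is_nat:
  fixes x :: rat
  assumes "x\<^sup>2 = of_nat n"
  obtains a where "\<bar>x\<bar> = of_nat a" "n = a\<^sup>2"
proof -
  obtain a where a: "x = of_int a"
    using rat_square_is_int[of x "int n"] assms by auto
  have abs: "\<bar>x\<bar> = of_nat (nat \<bar>a\<bar>)" by (simp add: a)
  have "(of_nat n :: rat) = of_nat ((nat \<bar>a\<bar>)\<^sup>2)"
    by (metis abs assms of_nat_power power2_abs)
  then have "n = (nat \<bar>a\<bar>)\<^sup>2" by (simp only: of_nat_eq_iff)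
  then show thesis using that abs by blast
qed

lemma rat_twice_square_is_int:
  fixes x :: rat
  assumes "2 * x\<^sup>2 = of_int n"
  obtains a where "n = 2 * a\<^sup>2"
proof -
  have "(2 * x)\<^sup>2 = of_int (2 * n)"
    using assms by (simp add: power2_eq_square)
  then obtain b where b: "2 * x = of_int b" by (rule rat_square_is_int)
  have "(of_int (b\<^sup>2) :: rat) = of_int (2 * n)"
    using \<open>(2 * x)\<^sup>2 = of_int (2 * n)\<close> by (simp add: b)
  then have n: "b\<^sup>2 = 2 * n" by (simp only: of_int_eq_iff)
  then have "even (b\<^sup>2)" by simp
  then obtain c where "b = 2 * c" by auto
  then have "n = 2 * c\<^sup>2" using n by (simp add: power2_eq_square)
  then show thesis by (rule that)
qed

lemma rat_abs_fractionE:
  fixes x :: rat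
  obtains p q :: nat where "coprime p q" "q > 0" "\<bar>x\<bar> = of_nat p / of_nat q"
proof -
  obtain a b where ab: "quotient_of x = (a, b)" by fastforce
  have x: "x = of_int a / of_int b" and "b > 0" and "coprime a b"
    using quotient_of_div[OF ab] quotient_of_denom_pos[OF ab] quotient_of_coprime[OF ab] by auto
  have "coprime (nat \<bar>a\<bar>) (nat \<bar>b\<bar>)" using \<open>coprime a b\<close> by simp
  moreover have "\<bar>x\<bar> = of_nat (nat \<bar>a\<bar>) / of_nat (nat \<bar>b\<bar>)" using \<open>b > 0\<close> by (simp add: x)
  moreover have "nat \<bar>b\<bar> > 0" using \<open>b > 0\<close> by simp
  ultimately show thesis by (intro that)
qed

lemma rat_power4_fractionE:
  fixes x :: rat
  obtains p q :: nat where "coprime p q" "q > 0" "x\<^sup>2 = (of_nat p)\<^sup>2 / (of_nat q)\<^sup>2"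
    "x ^ 4 = of_nat p ^ 4 / of_nat q ^ 4" "p = 0 \<longleftrightarrow> x = 0"
proof -
  obtain p q :: nat where pq: "coprime p q" "q > 0" "\<bar>x\<bar> = of_nat p / of_nat q"
    by (rule rat_abs_fractionE)
  have "x\<^sup>2 = (of_nat p / of_nat q)\<^sup>2" "x ^ 4 = (of_nat p / of_nat q) ^ 4"
    by (metis pq(3) power2_abs) (metis pq(3) power_even_abs_numeral even_numeral)
  moreover have "p = 0 \<longleftrightarrow> x = 0" using pq by (metis abs_eq_0 divide_eq_0_iff of_nat_eq_0_iff less_irrefl)
  ultimately show thesis using that[OF pq(1,2)] by (simp add: power_divide)
qed

section \<open>Rational solutions of the Fermat-type quartics, by clearing denominators\<close>

lemma rat_quartic_plus_1:
  fixes x y :: rat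
  assumes "x ^ 4 + 1 = y\<^sup>2"
  shows "x = 0"
proof (rule ccontr)
  assume "x \<noteq> 0"
  obtain p q :: nat where pq: "coprime p q" "q > 0" "x ^ 4 = of_nat p ^ 4 / of_nat q ^ 4" "p = 0 \<longleftrightarrow> x = 0"
    by (rule rat_power4_fractionE)
  have "(y * of_nat q ^ 2)\<^sup>2 = (x ^ 4 + 1) * of_nat q ^ 4"
    by (simp add: assms power_mult_distrib)
  also have "\<dots> = of_nat (p ^ 4 + q ^ 4)"
    using pq by (simp add: field_simps)
  finally obtain v where "p ^ 4 + q ^ 4 = v\<^sup>2" by (rule rat_square_is_nat)
  then show False
    using fourth_powers_sum_not_square[of p q v] pq \<open>x \<noteq> 0\<close> by simp
qed

lemma rat_quartic_plus_4:
  fixes x y :: rat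
  assumes "x ^ 4 + 4 = y\<^sup>2"
  shows "x = 0"
proof (rule ccontr)
  assume "x \<noteq> 0"
  obtain p q :: nat where pq: "coprime p q" "q > 0" "x ^ 4 = of_nat p ^ 4 / of_nat q ^ 4" "p = 0 \<longleftrightarrow> x = 0"
    by (rule rat_power4_fractionE)
  have "(y * of_nat q ^ 2)\<^sup>2 = (x ^ 4 + 4) * of_nat q ^ 4"
    by (simp add: assms power_mult_distrib)
  also have "\<dots> = of_nat (p ^ 4 + 4 * q ^ 4)"
    using pq by (simp add: field_simps)
  finally obtain v where "p ^ 4 + 4 * q ^ 4 = v\<^sup>2" by (rule rat_square_is_nat)
  then show False
    using fourth_power_plus_4_not_square[of p q v] pq \<open>x \<noteq> 0\<close> by simp
qed

text \<open>The conclusion concerns \<open>y\<close> because \<open>x = 1\<close> and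
  \<open>x = - 1\<close> are genuine solutions. The passage from \<open>rat\<close> to
  \<open>nat\<close> goes through \<open>int\<close>, where the difference of fourth powers is
  meaningful before its sign is known.\<close>

lemma rat_quartic_minus_1:
  fixes x y :: rat
  assumes "x ^ 4 - 1 = y\<^sup>2"
  shows "y = 0"
proof (rule ccontr)
  assume "y \<noteq> 0"
  obtain p q :: nat where pq: "coprime p q" "q > 0" "x ^ 4 = of_nat p ^ 4 / of_nat q ^ 4" "p = 0 \<longleftrightarrow> x = 0"
    by (rule rat_power4_fractionE)
  have sq: "(y * of_nat q ^ 2)\<^sup>2 = of_nat p ^ 4 - of_nat q ^ 4"
  proof -
    have "(y * of_nat q ^ 2)\<^sup>2 = (x ^ 4 - 1) * of_nat q ^ 4"
      by (simp add: assms power_mult_distrib)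
    also have "\<dots> = x ^ 4 * of_nat q ^ 4 - 1 * of_nat q ^ 4" by (simp only: left_diff_distrib)
    finally show ?thesis using pq by simp
  qed
  then have "(y * of_nat q ^ 2)\<^sup>2 = of_int (int p ^ 4 - int q ^ 4)"
    by simp
  then obtain a where a: "y * of_nat q ^ 2 = of_int a" by (rule rat_square_is_int)
  have "(of_int (int p ^ 4) :: rat) = of_int (int q ^ 4 + a\<^sup>2)"
    using sq by (simp add: a)
  then have "int p ^ 4 = int q ^ 4 + a\<^sup>2" by (simp only: of_int_eq_iff)
  also have "\<dots> = int (q ^ 4 + (nat \<bar>a\<bar>)\<^sup>2)" by simp
  finally have "p ^ 4 = q ^ 4 + (nat \<bar>a\<bar>)\<^sup>2" by (simp only: of_nat_eq_iff flip: of_nat_power)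
  moreover have "a \<noteq> 0" using a \<open>y \<noteq> 0\<close> pq by auto
  ultimately show False
    using fourth_powers_diff_not_square[of p q "nat \<bar>a\<bar>"] pq by simp
qed

lemma rat_quartic_minus_4:
  fixes x y :: rat
  shows "x ^ 4 - 4 \<noteq> y\<^sup>2"
proof
  assume asm: "x ^ 4 - 4 = y\<^sup>2"
  obtain p q :: nat where pq: "coprime p q" "q > 0" "x ^ 4 = of_nat p ^ 4 / of_nat q ^ 4" "p = 0 \<longleftrightarrow> x = 0"
    by (rule rat_power4_fractionE)
  have sq: "(y * of_nat q ^ 2)\<^sup>2 = of_nat p ^ 4 - 4 * of_nat q ^ 4"
  proof -
    have "(y * of_nat q ^ 2)\<^sup>2 = (x ^ 4 - 4) * of_nat q ^ 4"
      by (simp add: asm power_mult_distrib)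
    also have "\<dots> = x ^ 4 * of_nat q ^ 4 - 4 * of_nat q ^ 4" by (simp only: left_diff_distrib)
    finally show ?thesis using pq by simp
  qed
  then have "(y * of_nat q ^ 2)\<^sup>2 = of_int (int p ^ 4 - 4 * int q ^ 4)"
    by simp
  then obtain a where a: "y * of_nat q ^ 2 = of_int a" by (rule rat_square_is_int)
  have "(of_int (int p ^ 4) :: rat) = of_int (4 * int q ^ 4 + a\<^sup>2)"
    using sq by (simp add: a)
  then have "int p ^ 4 = 4 * int q ^ 4 + a\<^sup>2" by (simp only: of_int_eq_iff)
  also have "\<dots> = int (4 * q ^ 4 + (nat \<bar>a\<bar>)\<^sup>2)" by simp
  finally have "p ^ 4 = 4 * q ^ 4 + (nat \<bar>a\<bar>)\<^sup>2" by (simp only: of_nat_eq_iff flip: of_nat_power)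
  then show False
    using fourth_power_minus_4_not_square[of p q "nat \<bar>a\<bar>"] pq by simp
qed

text \<open>The map \<open>(x, y) \<mapsto> ((y/x)\<^sup>2, \<dots>)\<close> is the 2-isogeny from \<open>y\<^sup>2 = x\<^sup>3 + a x\<close> to
  \<open>y\<^sup>2 = x\<^sup>3 - 4 a x\<close>; its image has square abscissae, which gives a quartic of Fermat type.\<close>

lemma two_isogeny_quartic:
  fixes x y a :: "'a::field"
  assumes "y\<^sup>2 = x * (x\<^sup>2 + a)" "x \<noteq> 0"
  shows "(y / x) ^ 4 - 4 * a = ((x\<^sup>2 - a) / x)\<^sup>2"
proof -
  have "(y / x)\<^sup>2 = (x\<^sup>2 + a) / x"
    using assms by (simp add: power_divide power2_eq_square)
  then have "(y / x) ^ 4 = ((x\<^sup>2 + a) / x)\<^sup>2"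
    by (metis numeral_Bit0 power2_eq_square power_add)
  then show ?thesis using assms(2)
    by (simp add: field_simps power2_eq_square)
qed

section \<open>Rational points on the four curves obtained from \<open>x * (1 + x^2)\<close>,
  \<open>x * (1 - x^2)\<close> and their doubles\<close>

lemma rat_points_cubic_plus:
  fixes x y :: rat
  assumes "y\<^sup>2 = x * (1 + x\<^sup>2)"
  shows "x = 0"
proof (rule ccontr)
  assume "x \<noteq> 0"
  then show False
    using two_isogeny_quartic[of y x 1] assms rat_quartic_minus_4 by (simp add: add.commute)
qed

text \<open>Replacing \<open>x\<close>, \<open>y\<close> by \<open>2 * x\<close>,
  \<open>2 * y\<close> gives the isogeny lemma's form with \<open>a = 4\<close>. Dividing the
  resulting quartic by 16 leads to \<open>rat_quartic_minus_1\<close>.\<close>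

lemma rat_points_twice_cubic_plus:
  fixes x y :: rat
  assumes "y\<^sup>2 = 2 * x * (1 + x\<^sup>2)"
  shows "x = 0 \<or> x = 1"
proof (rule ccontr)
  assume x: "\<not> ?thesis"
  have "(y / (2 * x)) ^ 4 * 16 - 4 * 4 = (((2*x)\<^sup>2 - 4) / (2*x))\<^sup>2"
  proof -
    have "(2*y)\<^sup>2 = (2*x) * ((2*x)\<^sup>2 + 4)" using assms by (simp add: power_mult_distrib algebra_simps)
    then show ?thesis using two_isogeny_quartic[of "2*y" "2*x" 4] x by (simp add: power_divide)
  qed
  then have "(y / (2 * x)) ^ 4 - 1 = (((2*x)\<^sup>2 - 4) / (8*x))\<^sup>2"
    by (simp add: power_divide power_mult_distrib)
  then have "((2*x)\<^sup>2 - 4) / (8*x) = 0" by (rule rat_quartic_minus_1)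
  then have "x\<^sup>2 = 1" using x by (simp add: power_mult_distrib)
  then have "x = - 1" using x by (simp add: power2_eq_1_iff)
  then have "y\<^sup>2 = -4" using assms by simp
  then show False by (metis neg_numeral_less_zero not_less zero_le_power2)
qed

text \<open>The abscissa \<open>-x\<close> turns the curve into the isogeny form with
  \<open>a = -1\<close>; the resulting quartic has only solutions with \<open>y = 0\<close>.\<close>

lemma rat_points_cubic_minus:
  fixes x y :: rat
  assumes "y\<^sup>2 = x * (1 - x\<^sup>2)"
  shows "x = 0 \<or> x = 1 \<or> x = - 1"
proof (rule ccontr)
  assume x: "\<not> ?thesis"
  have "y\<^sup>2 = (-x) * ((-x)\<^sup>2 + (-1))" using assms by (simp add: algebra_simps)
  then have "(y / x) ^ 4 + 4 = ((x\<^sup>2 + 1) / x)\<^sup>2"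
    using two_isogeny_quartic[of y "-x" "-1"] x by simp
  then have "y / x = 0" by (rule rat_quartic_plus_4)
  then have "x\<^sup>2 = 1" using x assms by simp
  then show False using x by (simp add: power2_eq_1_iff)
qed

lemma rat_points_twice_cubic_minus:
  fixes x y :: rat
  assumes "y\<^sup>2 = 2 * x * (1 - x\<^sup>2)"
  shows "x = 0 \<or> x = 1 \<or> x = - 1"
proof (rule ccontr)
  assume x: "\<not> ?thesis"
  have "(2*y)\<^sup>2 = (-2*x) * ((-2*x)\<^sup>2 + (-4))" using assms by (simp add: power_mult_distrib algebra_simps)
  then have "(y / x) ^ 4 + 16 = (((2*x)\<^sup>2 + 4) / (2*x))\<^sup>2"
    using two_isogeny_quartic[of "2*y" "-2*x" "-4"] x by (simp add: power_divide power_mult_distrib)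
  then have "(y / (2*x)) ^ 4 + 1 = (((2*x)\<^sup>2 + 4) / (8*x))\<^sup>2"
    by (simp add: power_divide power_mult_distrib)
  then have "y / (2*x) = 0" by (rule rat_quartic_plus_1)
  then have "x\<^sup>2 = 1" using x assms by simp
  then show False using x by (simp add: power2_eq_1_iff)
qed

section \<open>Quartics taking twice a rational square as value\<close>

text \<open>The identity \<open>(m + 1)^4 + (m - 1)^4 = 2 * (m^4 + 6 * m^2 + 1)\<close> turns the
  left side into a sum of two fourth powers, so Fermat's result leaves only \<open>m = 1\<close> and
  \<open>m = -1\<close>.\<close>

lemma rat_quartic_plus_6_twice_square:
  fixes m k :: rat
  assumes "m ^ 4 + 6 * m\<^sup>2 + 1 = 2 * k\<^sup>2"
  shows "m\<^sup>2 = 1"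
proof -
  define a b where "a = (m + 1) / 2" and "b = (m - 1) / 2"
  have "8 * (a ^ 4 + b ^ 4) = m ^ 4 + 6 * m\<^sup>2 + 1"
    by (simp add: a_def b_def power_divide power4_eq_xxxx power2_eq_square field_simps)
  then have ab: "a ^ 4 + b ^ 4 = (k / 2)\<^sup>2"
    using assms by (simp add: power_divide)
  show ?thesis
  proof (cases "b = 0")
    case False
    have "(a / b) ^ 4 + 1 = (a ^ 4 + b ^ 4) / b ^ 4"
      using False by (simp add: power_divide field_simps)
    also have "\<dots> = (k / 2 / b\<^sup>2)\<^sup>2"
      unfolding ab by (simp add: power_divide)
    finally have "(a / b) ^ 4 + 1 = (k / 2 / b\<^sup>2)\<^sup>2" .
    then have "a / b = 0" by (rule rat_quartic_plus_1)
    then have "m = - 1" using False by (simp add: a_def)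
    then show ?thesis by simp
  qed (auto simp: b_def)
qed

lemma rat_quartic_clear_denominators:
  fixes m k :: rat and a b :: int
  assumes "m ^ 4 + of_int a * m\<^sup>2 + of_int b = 2 * k\<^sup>2"
  obtains p q c :: int where "coprime p q" "p ^ 4 + a * (p\<^sup>2 * q\<^sup>2) + b * q ^ 4 = 2 * c\<^sup>2"
proof -
  obtain p q :: nat where pq: "coprime p q" "q > 0" "m\<^sup>2 = (of_nat p)\<^sup>2 / (of_nat q)\<^sup>2" "m ^ 4 = of_nat p ^ 4 / of_nat q ^ 4"
    by (rule rat_power4_fractionE)
  have "2 * (k * of_nat q ^ 2)\<^sup>2 = (m ^ 4 + of_int a * m\<^sup>2 + of_int b) * of_nat q ^ 4"
    by (simp add: assms power_mult_distrib)
  also have "\<dots> = of_nat p ^ 4 + of_int a * (of_nat p ^ 2 * of_nat q ^ 2) + of_int b * of_nat q ^ 4"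
    unfolding pq(3,4) using pq(2) by (simp add: field_simps power4_eq_xxxx power2_eq_square)
  also have "\<dots> = of_int (int p ^ 4 + a * (int p ^ 2 * int q ^ 2) + b * int q ^ 4)"
    by simp
  finally obtain c where "int p ^ 4 + a * (int p ^ 2 * int q ^ 2) + b * int q ^ 4 = 2 * c\<^sup>2"
    by (rule rat_twice_square_is_int)
  then show thesis using that[of "int p" "int q" c] pq(1) by simp
qed

text \<open>A 2-adic obstruction: after clearing denominators, \<open>p\<close>, then
  \<open>c\<close>, then \<open>q\<close> is forced to be even, against coprimality.\<close>

lemma rat_quartic_pm4_not_twice_square:
  fixes m k e :: rat
  assumes "e = 1 \<or> e = -1"
  shows "m ^ 4 + 4 * e \<noteq> 2 * k\<^sup>2"
proof
  assume eq: "m ^ 4 + 4 * e = 2 * k\<^sup>2"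
  obtain e' :: int where e': "e = of_int e'" "odd e'"
    using assms by (metis of_int_1 of_int_minus odd_one even_minus)
  obtain p q c :: int where pq: "coprime p q" "p ^ 4 + 4 * e' * q ^ 4 = 2 * c\<^sup>2"
    using rat_quartic_clear_denominators[of m 0 "4 * e'" k] eq e' by auto
  have "even (p ^ 4)" using pq(2) by (metis dvd_add_left_iff dvd_mult2 dvd_triv_left even_mult_iff even_numeral)
  then obtain p' where p': "p = 2 * p'" by (auto elim: evenE)
  have c1: "8 * p' ^ 4 + 2 * e' * q ^ 4 = c\<^sup>2" using pq(2) by (simp add: p' power_mult_distrib)
  then have "even (c\<^sup>2)" by (metis dvd_add dvd_mult2 dvd_triv_left even_mult_iff even_numeral)
  then obtain c' where c': "c = 2 * c'" by (auto elim: evenE)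
  have "4 * p' ^ 4 + e' * q ^ 4 = 2 * c'\<^sup>2" using c1 by (simp add: c' power_mult_distrib)
  then have "even (e' * q ^ 4)" by (metis dvd_add_right_iff dvd_mult2 dvd_triv_left even_mult_iff even_numeral)
  then have "even q" using e'(2) by simp
  then show False using pq(1) p' by auto
qed

lemma odd_square_mod_8: "odd (x::int) \<Longrightarrow> x\<^sup>2 mod 8 = 1"
proof (elim oddE)
  fix b assume x: "x = 2 * b + 1"
  have "even (b * (b + 1))" by simp
  then obtain c where "b * (b + 1) = 2 * c" by (elim evenE)
  then have "x\<^sup>2 = 8 * c + 1" by (simp add: x power2_eq_square algebra_simps)
  then show ?thesis by presburger
qed

text \<open>An obstruction modulo 8: coprimality makes \<open>p\<close> and \<open>q\<close> odd,
  whence \<open>c^2\<close> is 6 modulo 8, which no square is.\<close>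

lemma rat_quartic_minus_6_not_twice_square:
  fixes m k :: rat
  shows "m ^ 4 - 6 * m\<^sup>2 + 1 \<noteq> 2 * k\<^sup>2"
proof
  assume eq: "m ^ 4 - 6 * m\<^sup>2 + 1 = 2 * k\<^sup>2"
  obtain p q c :: int where pq: "coprime p q" "p ^ 4 - 6 * (p\<^sup>2 * q\<^sup>2) + q ^ 4 = 2 * c\<^sup>2"
    using rat_quartic_clear_denominators[of m "-6" 1 k] eq by auto
  have "even (p ^ 4 - 6 * (p\<^sup>2 * q\<^sup>2) + q ^ 4)" using pq(2) by simp
  then have "even p \<longleftrightarrow> even q" by simp
  then have odd: "odd p" "odd q" using pq(1) by auto
  obtain a where a: "p\<^sup>2 = 8 * a + 1"
    using odd_square_mod_8[OF odd(1)] by (metis mult_div_mod_eq)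
  obtain b where b: "q\<^sup>2 = 8 * b + 1"
    using odd_square_mod_8[OF odd(2)] by (metis mult_div_mod_eq)
  have "p ^ 4 = (8 * a + 1)\<^sup>2" "q ^ 4 = (8 * b + 1)\<^sup>2"
    by (simp_all flip: a b)
  then have "c\<^sup>2 = 8 * (4 * a\<^sup>2 + 4 * b\<^sup>2 - 24 * a * b - 2 * a - 2 * b) - 2"
    using pq(2) unfolding a b by (simp add: power2_eq_square algebra_simps)
  then have "c\<^sup>2 mod 8 = 6" by presburger
  moreover have "even (c\<^sup>2)" using \<open>c\<^sup>2 = _\<close> by simp
  then obtain d where "c = 2 * d" by (auto elim: evenE)
  then have "c\<^sup>2 = 4 * d\<^sup>2" by (simp add: power_mult_distrib)
  ultimately show False by presburger
qed

subsection \<open>Subfields and quadratic extensions\<close>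

lemma ring_of_type_algebra_simps [simp]:
  "carrier (ring_of_type_algebra :: 'a::ring_1 ring) = UNIV"
  "x \<otimes>\<^bsub>ring_of_type_algebra\<^esub> y = x * y"
  "x \<oplus>\<^bsub>ring_of_type_algebra\<^esub> y = x + y"
  "\<one>\<^bsub>ring_of_type_algebra\<^esub> = 1"
  "\<zero>\<^bsub>ring_of_type_algebra\<^esub> = 0"
  by (simp_all add: ring_of_type_algebra_def)

interpretation type_ring: ring "ring_of_type_algebra :: 'a::comm_ring_1 ring"
  by (rule ring_from_type_algebra)

lemma a_inv_ring_of_type_algebra [simp]:
  "\<ominus>\<^bsub>ring_of_type_algebra\<^esub> x = - (x :: 'a::comm_ring_1)"
  by (rule type_ring.minus_equality) simp_all

lemma inv_ring_of_type_algebra [simp]: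
  assumes "x \<noteq> 0"
  shows "inv\<^bsub>ring_of_type_algebra\<^esub> x = inverse (x :: 'a::field)"
  using assms by (intro comm_monoid.comm_inv_char[OF cring.axioms(2)[OF cring_from_type_algebra]]) simp_all

lemma subfield_type_closed:
  fixes K :: "'a::field set"
  assumes "subfield K ring_of_type_algebra"
  shows "0 \<in> K" "1 \<in> K"
    and "x \<in> K \<Longrightarrow> - x \<in> K"
    and "x \<in> K \<Longrightarrow> y \<in> K \<Longrightarrow> x + y \<in> K"
    and "x \<in> K \<Longrightarrow> y \<in> K \<Longrightarrow> x - y \<in> K"
    and "x \<in> K \<Longrightarrow> y \<in> K \<Longrightarrow> x * y \<in> K"
    and "x \<in> K \<Longrightarrow> inverse x \<in> K"
    and "x \<in> K \<Longrightarrow> y \<in> K \<Longrightarrow> x / y \<in> K"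
    and "x \<in> K \<Longrightarrow> x ^ n \<in> K"
    and "numeral m \<in> K"
proof -
  note sr = subringE[OF subfieldE(1)[OF assms]]
  show zero: "0 \<in> K" and one: "1 \<in> K" using sr by auto
  show uminus: "- x \<in> K" if "x \<in> K" for x using sr(5)[OF that] by simp
  show add: "x + y \<in> K" if "x \<in> K" "y \<in> K" for x y using sr(7)[OF that] by simp
  show mult: "x * y \<in> K" if "x \<in> K" "y \<in> K" for x y using sr(6)[OF that] by simp
  show inverse: "inverse x \<in> K" if "x \<in> K" for x
    using type_ring.subfield_m_inv(1)[OF assms, of x] that zero by (cases "x = 0") auto
  show "x - y \<in> K" if "x \<in> K" "y \<in> K" for x y
    using add[OF that(1) uminus[OF that(2)]] by simp
  show "x / y \<in> K" if "x \<in> K" "y \<in> K" for x y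
    using mult[OF that(1) inverse[OF that(2)]] by (simp add: divide_inverse)
  show "x ^ n \<in> K" if "x \<in> K" for x n
    by (induction n) (use one mult that in auto)
  show "numeral m \<in> K" for m
    by (induction m) (simp_all only: numeral.simps one add)
qed

lemma Q_adjoin_subfield: "subfield (Q_adjoin S) ring_of_type_algebra"
  unfolding Q_adjoin_def by (rule field.generate_field_is_subfield[OF field_from_type_algebra]) simp

lemma Q_adjoin_incl: "x \<in> S \<Longrightarrow> x \<in> Q_adjoin S"
  unfolding Q_adjoin_def by (rule generate_field.incl)

lemmas Q_adjoin_closed = subfield_type_closed[OF Q_adjoin_subfield]

lemma Q_adjoin_mono:
  assumes "S \<subseteq> T"
  shows "Q_adjoin S \<subseteq> Q_adjoin T"
  using field.generate_field_min_subfield1[OF field_from_type_algebra _ Q_adjoin_subfield[of T], of S] assms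
  unfolding Q_adjoin_def by (auto intro: generate_field.incl)

text \<open>For \<open>t\<close> outside \<open>K\<close> the list \<open>[t, 1]\<close> is
  independent, and its length equals the dimension, so it spans \<open>F\<close>.\<close>

lemma quadratic_extension_decompose:
  fixes K F :: "'a::field set"
  assumes "quadratic_extension K F" "t \<in> F" "t \<notin> K" "x \<in> F"
  obtains a b where "a \<in> K" "b \<in> K" "x = a * t + b"
proof -
  have K: "subfield K ring_of_type_algebra" and F: "subfield F ring_of_type_algebra"
    and "K \<subseteq> F" and dim: "type_ring.dimension 2 K F"
    using assms(1) by (auto simp: quadratic_extension_def)
  interpret K: subfield K "ring_of_type_algebra :: 'a ring" by (rule K)
  note closed = subfield_type_closed[OF K]
  have span1: "type_ring.Span K [1] \<subseteq> K"
    by (auto simp: type_ring.line_extension_mem_iff intro!: closed)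
  have "type_ring.independent K [1]"
    by (rule type_ring.li_Cons) (auto intro: type_ring.li_Nil)
  then have "type_ring.independent K [t, 1]"
    using span1 \<open>t \<notin> K\<close> by (intro type_ring.li_Cons) auto
  moreover have "set [t, 1] \<subseteq> F"
    using \<open>t \<in> F\<close> subfield_type_closed(2)[OF F] by simp
  ultimately have "type_ring.Span K [t, 1] = F"
    using type_ring.independent_length_eq_dimension[OF K dim, of "[t, 1]"] by simp
  then have "x \<in> type_ring.Span K [t, 1]"
    using \<open>x \<in> F\<close> by simp
  then show thesis
    using that span1 by (auto simp: type_ring.line_extension_mem_iff)
qed

lemma linear_independent_outside_subfield:
  fixes K :: "'a::field set"
  assumes "subfield K ring_of_type_algebra" "t \<notin> K" "a \<in> K" "b \<in> K" "a' \<in> K" "b' \<in> K"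
    and "a * t + b = a' * t + b'"
  shows "a = a' \<and> b = b'"
proof -
  note closed = subfield_type_closed[OF assms(1)]
  have "a = a'"
  proof (rule ccontr)
    assume "a \<noteq> a'"
    then have "t = (b' - b) / (a - a')" using assms(7) by (simp add: field_simps)
    then show False using assms(2-6) closed by auto
  qed
  then show ?thesis using assms(7) by simp
qed

text \<open>If \<open>t\<close> is quadratic with trace \<open>B\<close> and norm \<open>C\<close>, and the line \<open>y = m\<^sub>1 x + m\<^sub>0\<close> passes through
  the point of \<open>y\<^sup>2 = c x + d x\<^sup>3\<close> over \<open>t\<close> and through its conjugate, then \<open>e\<close> is the abscissa of the
  third point of intersection. The two hypotheses are the coefficients of \<open>t\<close> and \<open>1\<close> in
  \<open>(m\<^sub>1 t + m\<^sub>0)\<^sup>2 = c t + d t\<^sup>3\<close>.\<close>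

lemma cubic_chord:
  fixes c d B C m1 m0 e :: "'a::field"
  assumes "m1\<^sup>2 * B + 2 * m1 * m0 = c + d * (B\<^sup>2 - C)" "m0\<^sup>2 - m1\<^sup>2 * C = - d * B * C" "d \<noteq> 0"
  defines "e \<equiv> m1\<^sup>2 / d - B"
  shows "m1\<^sup>2 = d * (B + e)" "m0\<^sup>2 = d * C * e" "2 * m1 * m0 = c - d * (C + B * e)"
    "(m1 * e + m0)\<^sup>2 = c * e + d * e ^ 3"
proof -
  show m1: "m1\<^sup>2 = d * (B + e)" using \<open>d \<noteq> 0\<close> by (simp add: e_def)
  show m0: "m0\<^sup>2 = d * C * e"
    using assms(2) unfolding m1 by (simp add: algebra_simps)
  show m10: "2 * m1 * m0 = c - d * (C + B * e)"
    using assms(1) unfolding m1 by (simp add: algebra_simps power2_eq_square add_eq_0_iff2) algebra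
  have "(m1 * e + m0)\<^sup>2 = m1\<^sup>2 * e\<^sup>2 + (2 * m1 * m0) * e + m0\<^sup>2"
    by (simp add: power2_eq_square algebra_simps)
  also have "\<dots> = c * e + d * e ^ 3"
    unfolding m1 m0 m10 by (simp add: power2_eq_square power3_eq_cube algebra_simps)
  finally show "(m1 * e + m0)\<^sup>2 = c * e + d * e ^ 3" .
qed

text \<open>Reducing \<open>t ^ 3\<close> by the quadratic equation of \<open>t\<close> and
  comparing coefficients supplies the hypotheses of \<open>cubic_chord\<close>. The abscissa
  \<open>m1^2 / d - B\<close> lies in \<open>K\<close> because its ingredients do.\<close>

lemma quadratic_cubic_chord:
  fixes K :: "'a::field set"
  assumes K: "subfield K ring_of_type_algebra" and t: "t \<notin> K" "t\<^sup>2 = B * t - C"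
    and mem: "B \<in> K" "C \<in> K" "m1 \<in> K" "m0 \<in> K" "c \<in> K" "d \<in> K" and "d \<noteq> 0"
    and eq: "(m1 * t + m0)\<^sup>2 = c * t + d * t ^ 3"
  obtains e where "e \<in> K" "m1\<^sup>2 = d * (B + e)" "m0\<^sup>2 = d * C * e" "2 * m1 * m0 = c - d * (C + B * e)"
    "(m1 * e + m0)\<^sup>2 = c * e + d * e ^ 3"
proof -
  note closed = subfield_type_closed[OF K]
  have t3: "t ^ 3 = (B\<^sup>2 - C) * t - B * C"
  proof -
    have "t ^ 3 = t\<^sup>2 * t" by (simp add: power2_eq_square power3_eq_cube)
    also have "\<dots> = B * t\<^sup>2 - C * t" 
    proof -
      have "t\<^sup>2 * t = (B * t - C) * t" by (simp only: t(2))
      then show ?thesis by (simp add: algebra_simps power2_eq_square)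
    qed
    also have "\<dots> = (B\<^sup>2 - C) * t - B * C" by (simp only: t(2)) (simp add: algebra_simps power2_eq_square)
    finally show ?thesis .
  qed
  have "(m1\<^sup>2 * B + 2 * m1 * m0) * t + (m0\<^sup>2 - m1\<^sup>2 * C) = m1\<^sup>2 * (B * t - C) + 2 * m1 * m0 * t + m0\<^sup>2"
    by (simp add: algebra_simps)
  also have "\<dots> = (m1 * t + m0)\<^sup>2"
    unfolding t(2)[symmetric] by (simp add: power2_eq_square algebra_simps)
  also have "\<dots> = (c + d * (B\<^sup>2 - C)) * t + (- d * B * C)"
    unfolding eq t3 by (simp add: algebra_simps)
  finally have "(m1\<^sup>2 * B + 2 * m1 * m0) * t + (m0\<^sup>2 - m1\<^sup>2 * C) = (c + d * (B\<^sup>2 - C)) * t + (- d * B * C)" .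
  then have "m1\<^sup>2 * B + 2 * m1 * m0 = c + d * (B\<^sup>2 - C) \<and> m0\<^sup>2 - m1\<^sup>2 * C = - d * B * C"
    using mem by (intro linear_independent_outside_subfield[OF K t(1)]) (auto intro!: closed)
  then have "m1\<^sup>2 * B + 2 * m1 * m0 = c + d * (B\<^sup>2 - C)" "m0\<^sup>2 - m1\<^sup>2 * C = - d * B * C"
    by blast+
  note e = cubic_chord[OF this \<open>d \<noteq> 0\<close>]
  show thesis
    by (rule that[OF _ e]) (intro closed mem)
qed

subsection \<open>Elliptic curves over \<open>\<rat>(\<surd>2)\<close>\<close>

lemma rat_sqrt_2:
  fixes a b :: rat
  assumes "a\<^sup>2 = 2 * b\<^sup>2"
  shows "a = 0 \<and> b = 0"
proof (cases "b = 0")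
  case False
  have "(a / b)\<^sup>2 = of_nat 2" using assms False by (simp add: power_divide)
  then obtain n :: nat where "2 = n\<^sup>2" by (rule rat_square_is_nat)
  then have "even (n\<^sup>2)" by (metis dvd_refl)
  then obtain m where "n = 2 * m" by (auto elim: evenE)
  then have "(2::nat) = 4 * m\<^sup>2" using \<open>2 = n\<^sup>2\<close> by simp
  then show ?thesis by presburger
qed (use assms in auto)

context
  fixes s :: "'a::field_char_0"
  assumes s: "s\<^sup>2 = 2"
begin

lemma sqrt2_independent:
  assumes "of_rat a + of_rat b * s = of_rat c + of_rat d * s"
  shows "a = c \<and> b = d"
proof -
  have "of_rat (a - c) = of_rat (d - b) * s"
    using assms by (simp add: of_rat_diff algebra_simps)
  then have "(of_rat (a - c))\<^sup>2 = (of_rat (d - b) * s)\<^sup>2" by simp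
  also have "\<dots> = of_rat (2 * (d - b)\<^sup>2)"
    by (simp add: power_mult_distrib s of_rat_mult of_rat_power)
  finally have "(of_rat ((a - c)\<^sup>2) :: 'a) = of_rat (2 * (d - b)\<^sup>2)"
    by (simp add: of_rat_power)
  then have "(a - c)\<^sup>2 = 2 * (d - b)\<^sup>2" by (simp only: of_rat_eq_iff)
  then show ?thesis using rat_sqrt_2[of "a - c" "d - b"] by simp
qed

lemma Q_sqrt2_cases:
  assumes "x \<in> Q_adjoin {s}"
  obtains a b where "x = of_rat a + of_rat b * s"
proof -
  have "\<exists>a b. x = of_rat a + of_rat b * s"
    using assms unfolding Q_adjoin_def
  proof (induction rule: generate_field.induct)
    case one
    show ?case by (rule exI[of _ 1], rule exI[of _ 0]) simp
  next
    case (incl h)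
    then show ?case by (intro exI[of _ 0] exI[of _ 1]) simp
  next
    case (a_inv h)
    then obtain a b where "h = of_rat a + of_rat b * s" by blast
    then show ?case by (intro exI[of _ "-a"] exI[of _ "-b"]) (simp add: of_rat_minus)
  next
    case (m_inv h)
    then obtain a b where h: "h = of_rat a + of_rat b * s" by blast
    \<comment> \<open>\<open>n\<close> is the norm of \<open>h\<close>, nonzero by irrationality of
      the square root of 2; the inverse is the conjugate divided by the norm.\<close>
    define n where "n = a\<^sup>2 - 2 * b\<^sup>2"
    have "h \<noteq> 0" using m_inv by simp
    then have "n \<noteq> 0" using rat_sqrt_2[of a b] h by (auto simp: n_def)
    have "(of_rat a + of_rat b * s) * (of_rat a - of_rat b * s) = (of_rat a)\<^sup>2 - (of_rat b)\<^sup>2 * s\<^sup>2"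
      by (simp add: algebra_simps power2_eq_square)
    then have "h * (of_rat a - of_rat b * s) = of_rat n"
      by (simp add: h s n_def of_rat_diff of_rat_mult of_rat_power)
    then have "inverse h = (of_rat a - of_rat b * s) / of_rat n"
      using \<open>h \<noteq> 0\<close> \<open>n \<noteq> 0\<close> by (simp add: field_simps)
    also have "\<dots> = of_rat (a / n) + of_rat (- b / n) * s"
      by (simp add: of_rat_divide of_rat_minus diff_divide_distrib)
    finally show ?case using \<open>h \<noteq> 0\<close> by auto
  next
    case (eng_add h1 h2)
    then obtain a b c d where "h1 = of_rat a + of_rat b * s" "h2 = of_rat c + of_rat d * s" by blast
    then show ?case
      by (intro exI[of _ "a + c"] exI[of _ "b + d"]) (simp add: of_rat_add algebra_simps)
  next
    case (eng_mult h1 h2)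
    then obtain a b c d where h: "h1 = of_rat a + of_rat b * s" "h2 = of_rat c + of_rat d * s" by blast
    have "h1 * h2 = of_rat a * of_rat c + of_rat b * of_rat d * s\<^sup>2 + (of_rat a * of_rat d + of_rat b * of_rat c) * s"
      by (simp add: h power2_eq_square algebra_simps)
    then show ?case
      by (intro exI[of _ "a * c + b * d * 2"] exI[of _ "a * d + b * c"]) (simp add: s of_rat_add of_rat_mult)
  qed
  then show thesis using that by blast
qed

text \<open>If the root has coordinates \<open>a\<close> and \<open>b\<close>, then
  \<open>c = a^2 + 2 * b^2\<close> and the norm \<open>c^2 - 2 * d^2\<close> equals
  \<open>(a^2 - 2 * b^2)^2\<close>. These sign conditions later serve to recognize
  nonsquares.\<close>

lemma Q_sqrt2_square:
  assumes "x \<in> Q_adjoin {s}" "x\<^sup>2 = of_rat c + of_rat d * s"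
  shows "0 \<le> c" "2 * d\<^sup>2 \<le> c\<^sup>2"
proof -
  obtain a b where x: "x = of_rat a + of_rat b * s" by (rule Q_sqrt2_cases[OF assms(1)])
  have "x\<^sup>2 = (of_rat a)\<^sup>2 + (of_rat b)\<^sup>2 * s\<^sup>2 + 2 * of_rat a * of_rat b * s"
    by (simp add: x power2_eq_square algebra_simps)
  also have "\<dots> = of_rat (a\<^sup>2 + 2 * b\<^sup>2) + of_rat (2 * a * b) * s"
    by (simp add: s of_rat_add of_rat_mult of_rat_power)
  finally have "c = a\<^sup>2 + 2 * b\<^sup>2 \<and> d = 2 * a * b"
    by (intro sqrt2_independent) (simp flip: assms(2))
  moreover have "0 \<le> (a\<^sup>2 - 2 * b\<^sup>2)\<^sup>2" by simp
  ultimately show "0 \<le> c" "2 * d\<^sup>2 \<le> c\<^sup>2"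
    by (simp_all add: power2_eq_square algebra_simps)
qed

text \<open>In the last case \<open>x\<close> is irrational, and \<open>e\<close> is the abscissa of the third point on the
  line through \<open>(x, v)\<close> and its conjugate, which is a rational point of the same curve.\<close>

lemma Q_sqrt2_cubic_cases:
  fixes \<epsilon> :: rat
  assumes "v \<in> Q_adjoin {s}" "x = of_rat a + of_rat b * s"
    and eq: "v\<^sup>2 = x + of_rat \<epsilon> * x ^ 3" and "\<epsilon> \<noteq> 0"
  obtains (rational) p where "b = 0" "p\<^sup>2 = a + \<epsilon> * a ^ 3"
    | (twisted) q where "b = 0" "2 * q\<^sup>2 = a + \<epsilon> * a ^ 3"
    | (chord) m1 m0 e where "b \<noteq> 0" "m1\<^sup>2 = \<epsilon> * (2 * a + e)" "m0\<^sup>2 = \<epsilon> * (a\<^sup>2 - 2 * b\<^sup>2) * e"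
      "2 * m1 * m0 = 1 - \<epsilon> * (a\<^sup>2 - 2 * b\<^sup>2 + 2 * a * e)" "(m1 * e + m0)\<^sup>2 = e + \<epsilon> * e ^ 3"
proof -
  obtain p q where v: "v = of_rat p + of_rat q * s" by (rule Q_sqrt2_cases[OF assms(1)])
  have "v\<^sup>2 = (of_rat p)\<^sup>2 + (of_rat q)\<^sup>2 * s\<^sup>2 + 2 * of_rat p * of_rat q * s"
    by (simp add: v power2_eq_square algebra_simps)
  then have v2: "v\<^sup>2 = of_rat (p\<^sup>2 + 2 * q\<^sup>2) + of_rat (2 * p * q) * s"
    by (simp add: s of_rat_add of_rat_mult of_rat_power)
  have "x ^ 3 = (of_rat a) ^ 3 + 3 * of_rat a * (of_rat b)\<^sup>2 * s\<^sup>2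
      + (3 * (of_rat a)\<^sup>2 * of_rat b + (of_rat b) ^ 3 * s\<^sup>2) * s"
    by (simp add: assms(2) power2_eq_square power3_eq_cube algebra_simps)
  then have "x + of_rat \<epsilon> * x ^ 3 = of_rat (a + \<epsilon> * (a ^ 3 + 6 * a * b\<^sup>2))
      + of_rat (b + \<epsilon> * (3 * a\<^sup>2 * b + 2 * b ^ 3)) * s"
    by (simp add: assms(2) s of_rat_add of_rat_mult of_rat_power algebra_simps)
  then have coeffs: "p\<^sup>2 + 2 * q\<^sup>2 = a + \<epsilon> * (a ^ 3 + 6 * a * b\<^sup>2)"
      "2 * p * q = b + \<epsilon> * (3 * a\<^sup>2 * b + 2 * b ^ 3)"
    using sqrt2_independent eq v2 by metis+
  show thesis
  proof (cases "b = 0")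
    case True
    \<comment> \<open>For rational \<open>x\<close> the ordinate \<open>v\<close> is rational or a
      rational multiple of \<open>s\<close>; the latter is a rational point on the twist by
      2.\<close>
    then have "p = 0 \<or> q = 0" using coeffs(2) by simp
    then show thesis using coeffs(1) True rational twisted by auto
  next
    case False
    \<comment> \<open>The line through \<open>(x, v)\<close> and its conjugate:
      \<open>v = m1 * x + m0\<close> with rational coefficients. The trace and norm of
      \<open>x\<close> are \<open>2 * a\<close> and \<open>a^2 - 2 * b^2\<close>.\<close>
    define m1 m0 where "m1 = q / b" and "m0 = p - m1 * a"
    have q: "q = m1 * b" and p: "p = m0 + m1 * a" using False by (simp_all add: m1_def m0_def)
    have "b * (2 * m0 * m1 + 2 * m1\<^sup>2 * a) = b * (1 + \<epsilon> * (3 * a\<^sup>2 + 2 * b\<^sup>2))"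
      using coeffs(2) by (simp add: p q power2_eq_square power3_eq_cube algebra_simps)
    then have c2: "2 * m0 * m1 + 2 * m1\<^sup>2 * a = 1 + \<epsilon> * (3 * a\<^sup>2 + 2 * b\<^sup>2)"
      using False by simp
    have c1: "m0\<^sup>2 + m1\<^sup>2 * a\<^sup>2 + 2 * m0 * m1 * a + 2 * m1\<^sup>2 * b\<^sup>2 = a + \<epsilon> * (a ^ 3 + 6 * a * b\<^sup>2)"
      using coeffs(1) by (simp add: p q power2_eq_square algebra_simps)
    have "m1\<^sup>2 * (2 * a) + 2 * m1 * m0 = 1 + \<epsilon> * ((2 * a)\<^sup>2 - (a\<^sup>2 - 2 * b\<^sup>2))"
      using c2 by (simp add: power2_eq_square algebra_simps)
    moreover have "m0\<^sup>2 - m1\<^sup>2 * (a\<^sup>2 - 2 * b\<^sup>2) = - \<epsilon> * (2 * a) * (a\<^sup>2 - 2 * b\<^sup>2)"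
    proof -
      have "2 * m0 * m1 * a + 2 * m1\<^sup>2 * a * a = a + \<epsilon> * (3 * a\<^sup>2 + 2 * b\<^sup>2) * a"
        using arg_cong[OF c2, of "\<lambda>x. x * a"] by (simp add: algebra_simps)
      then show ?thesis using c1 by (simp add: power2_eq_square power3_eq_cube algebra_simps)
    qed
    ultimately have ch: "m1\<^sup>2 = \<epsilon> * (2 * a + (m1\<^sup>2 / \<epsilon> - 2 * a))"
      "m0\<^sup>2 = \<epsilon> * (a\<^sup>2 - 2 * b\<^sup>2) * (m1\<^sup>2 / \<epsilon> - 2 * a)"
      "2 * m1 * m0 = 1 - \<epsilon> * (a\<^sup>2 - 2 * b\<^sup>2 + 2 * a * (m1\<^sup>2 / \<epsilon> - 2 * a))"
      "(m1 * (m1\<^sup>2 / \<epsilon> - 2 * a) + m0)\<^sup>2 = 1 * (m1\<^sup>2 / \<epsilon> - 2 * a) + \<epsilon> * (m1\<^sup>2 / \<epsilon> - 2 * a) ^ 3"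
      using \<open>\<epsilon> \<noteq> 0\<close> by (rule cubic_chord)+
    then show thesis by (intro chord[OF False ch(1-3)]) simp
  qed
qed

text \<open>Dividing \<open>w\<close> by \<open>s\<close> removes the factor 2, so that
  \<open>Q_sqrt2_cubic_cases\<close> applies. In the chord case the third point can only be the
  origin, and then \<open>m1\<close> solves a quartic that is impossible 2-adically.\<close>

lemma Q_sqrt2_elliptic_plus:
  assumes "x \<in> Q_adjoin {s}" "w \<in> Q_adjoin {s}" "w\<^sup>2 = 2 * x * (1 + x\<^sup>2)"
  shows "x = 0 \<or> x = 1"
proof -
  obtain a b where x: "x = of_rat a + of_rat b * s" by (rule Q_sqrt2_cases[OF assms(1)])
  have "w / s \<in> Q_adjoin {s}" using assms(2) by (intro Q_adjoin_closed) (auto intro: Q_adjoin_incl)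
  moreover have "(w / s)\<^sup>2 = x + of_rat 1 * x ^ 3"
  proof -
    have "(w / s)\<^sup>2 = w\<^sup>2 / 2" by (simp only: power_divide s)
    also have "\<dots> = x * (1 + x\<^sup>2)" unfolding assms(3) by simp
    also have "\<dots> = x + of_rat 1 * x ^ 3"
      by (simp add: power2_eq_square power3_eq_cube algebra_simps)
    finally show ?thesis .
  qed
  ultimately show ?thesis
  proof (rule Q_sqrt2_cubic_cases[OF _ x])
    fix p assume "b = 0" "p\<^sup>2 = a + 1 * a ^ 3"
    then show ?thesis using rat_points_cubic_plus[of p a] x
      by (simp add: power2_eq_square power3_eq_cube algebra_simps)
  next
    fix q assume "b = 0" "2 * q\<^sup>2 = a + 1 * a ^ 3"
    then show ?thesis using rat_points_twice_cubic_plus[of "2 * q" a] x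
      by (auto simp add: power2_eq_square power3_eq_cube algebra_simps)
  next
    fix m1 m0 e
    assume *: "b \<noteq> 0" "m1\<^sup>2 = 1 * (2 * a + e)" "m0\<^sup>2 = 1 * (a\<^sup>2 - 2 * b\<^sup>2) * e"
      "2 * m1 * m0 = 1 - 1 * (a\<^sup>2 - 2 * b\<^sup>2 + 2 * a * e)" "(m1 * e + m0)\<^sup>2 = e + 1 * e ^ 3"
    have "e = 0"
      using rat_points_cubic_plus[of "m1 * e + m0" e] *(5) by (simp add: power2_eq_square power3_eq_cube algebra_simps)
    then have "m1\<^sup>2 = 2 * a" "a\<^sup>2 - 2 * b\<^sup>2 = 1" using * by auto
    then have "m1 ^ 4 = (2 * a)\<^sup>2" by (metis numeral_Bit0 power2_eq_square power_add)
    then have "m1 ^ 4 + 4 * (-1) = 2 * (2 * b)\<^sup>2"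
      using \<open>a\<^sup>2 - 2 * b\<^sup>2 = 1\<close> by (simp add: power_mult_distrib algebra_simps)
    then show ?thesis using rat_quartic_pm4_not_twice_square[of "-1"] by blast
  qed simp
qed

text \<open>As for the other sign, but the third point may have abscissa 0, 1 or -1, each giving its
  own quartic in \<open>m1\<close>. Only abscissa 1 is solvable, and it produces the two irrational
  points \<open>- 1 + s\<close> and \<open>- 1 - s\<close>.\<close>

lemma Q_sqrt2_elliptic_minus:
  assumes "x \<in> Q_adjoin {s}" "w \<in> Q_adjoin {s}" "w\<^sup>2 = 2 * x * (1 - x\<^sup>2)"
  shows "x = 0 \<or> x = 1 \<or> x = - 1 \<or> x = - 1 + s \<or> x = - 1 - s"
proof -
  obtain a b where x: "x = of_rat a + of_rat b * s" by (rule Q_sqrt2_cases[OF assms(1)])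
  have "w / s \<in> Q_adjoin {s}" using assms(2) by (intro Q_adjoin_closed) (auto intro: Q_adjoin_incl)
  moreover have "(w / s)\<^sup>2 = x + of_rat (-1) * x ^ 3"
  proof -
    have "(w / s)\<^sup>2 = w\<^sup>2 / 2" by (simp only: power_divide s)
    also have "\<dots> = x * (1 - x\<^sup>2)" unfolding assms(3) by simp
    also have "\<dots> = x + of_rat (-1) * x ^ 3"
      by (simp add: power2_eq_square power3_eq_cube algebra_simps)
    finally show ?thesis .
  qed
  ultimately show ?thesis
  proof (rule Q_sqrt2_cubic_cases[OF _ x])
    fix p assume "b = 0" "p\<^sup>2 = a + (-1) * a ^ 3"
    then show ?thesis using rat_points_cubic_minus[of p a] x
      by (auto simp add: power2_eq_square power3_eq_cube algebra_simps)
  next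
    fix q assume "b = 0" "2 * q\<^sup>2 = a + (-1) * a ^ 3"
    then show ?thesis using rat_points_twice_cubic_minus[of "2 * q" a] x
      by (auto simp add: power2_eq_square power3_eq_cube algebra_simps)
  next
    fix m1 m0 e
    assume *: "b \<noteq> 0" "m1\<^sup>2 = (-1) * (2 * a + e)" "m0\<^sup>2 = (-1) * (a\<^sup>2 - 2 * b\<^sup>2) * e"
      "2 * m1 * m0 = 1 - (-1) * (a\<^sup>2 - 2 * b\<^sup>2 + 2 * a * e)" "(m1 * e + m0)\<^sup>2 = e + (-1) * e ^ 3"
    have m14: "m1 ^ 4 = (m1\<^sup>2)\<^sup>2" by simp
    have "e = 0 \<or> e = 1 \<or> e = - 1"
      using rat_points_cubic_minus[of "m1 * e + m0" e] *(5) by (simp add: power2_eq_square power3_eq_cube algebra_simps)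
    then show ?thesis
    proof (elim disjE)
      assume e: "e = 0"
      then have "m1\<^sup>2 = - 2 * a" "a\<^sup>2 - 2 * b\<^sup>2 = - 1" using * by auto
      then have "m1 ^ 4 + 4 * 1 = 2 * (2 * b)\<^sup>2"
        unfolding m14 by (simp add: power_mult_distrib algebra_simps)
      then show ?thesis using rat_quartic_pm4_not_twice_square[of "1"] by blast
    next
      assume e: "e = 1"
      then have "m0 = - m1" using *(5) by (simp add: add_eq_0_iff)
      then have a: "2 * a = - 1 - m1\<^sup>2" and b: "2 * b\<^sup>2 = a\<^sup>2 + m1\<^sup>2" using *(2,3) e by auto
      have "2 * (2 * b)\<^sup>2 = (2 * a)\<^sup>2 + 4 * m1\<^sup>2" using b by (simp add: power_mult_distrib)
      also have "\<dots> = m1 ^ 4 + 6 * m1\<^sup>2 + 1" unfolding a m14 by (simp add: power2_eq_square algebra_simps)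
      finally have "m1\<^sup>2 = 1" using rat_quartic_plus_6_twice_square[of m1 "2 * b"] by simp
      then have "a = - 1" "b\<^sup>2 = 1" using a b by auto
      then show ?thesis using x by (auto simp: power2_eq_1_iff of_rat_minus)
    next
      assume e: "e = - 1"
      then have "m0 = m1" using *(5) by simp
      then have a: "2 * a = 1 - m1\<^sup>2" and b: "2 * b\<^sup>2 = a\<^sup>2 - m1\<^sup>2" using *(2,3) e by auto
      have "2 * (2 * b)\<^sup>2 = (2 * a)\<^sup>2 - 4 * m1\<^sup>2" using b by (simp add: power_mult_distrib)
      also have "\<dots> = m1 ^ 4 - 6 * m1\<^sup>2 + 1" unfolding a m14 by (simp add: power2_eq_square algebra_simps)
      finally show ?thesis using rat_quartic_minus_6_not_twice_square[of m1 "2 * b"] by simp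
    qed
  qed simp
qed

end

subsection \<open>Points on the Fermat quartic\<close>

text \<open>The first two values have negative rational part, the other four have negative
  norm.\<close>

lemma Q_sqrt2_nonsquares:
  fixes s :: "'a::field_char_0"
  assumes s: "s\<^sup>2 = 2" and x: "x \<in> Q_adjoin {s}"
  shows "x\<^sup>2 \<noteq> - 1" "x\<^sup>2 \<noteq> - 2" "x\<^sup>2 \<noteq> 1 + s" "x\<^sup>2 \<noteq> 1 - s" "x\<^sup>2 \<noteq> 2 + 2 * s" "x\<^sup>2 \<noteq> 2 - 2 * s"
proof -
  note sq = Q_sqrt2_square[OF s x]
  show "x\<^sup>2 \<noteq> - 1" using sq(1)[of "-1" 0] by (auto simp: of_rat_minus)
  show "x\<^sup>2 \<noteq> - 2" using sq(1)[of "-2" 0] by (auto simp: of_rat_minus)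
  show "x\<^sup>2 \<noteq> 1 + s" using sq(2)[of 1 1] by auto
  show "x\<^sup>2 \<noteq> 1 - s" using sq(2)[of 1 "-1"] by (auto simp: of_rat_minus)
  show "x\<^sup>2 \<noteq> 2 + 2 * s" using sq(2)[of 2 2] by auto
  show "x\<^sup>2 \<noteq> 2 - 2 * s" using sq(2)[of 2 "-2"] by (auto simp: of_rat_minus)
qed

text \<open>The third points on the two curves have abscissae \<open>e\<close> and \<open>f\<close>,
  which leaves ten pairs. All but two demand a square that does not exist or contradict the chord
  equations. The pair \<open>(0, -1)\<close> gives trace 0 and norm 1, the pair
  \<open>(1, -1)\<close> gives trace -1 and norm 2.\<close>

lemma quadratic_parameter_irrational:
  fixes F :: "'a::field_char_0 set"
  assumes s: "s\<^sup>2 = 2" and F: "quadratic_extension (Q_adjoin {s}) F"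
    and t: "t \<in> F" "t \<notin> Q_adjoin {s}"
    and w: "w \<in> F" "w\<^sup>2 = 2 * t * (1 + t\<^sup>2)" and v: "v \<in> F" "v\<^sup>2 = 2 * t * (1 - t\<^sup>2)"
  shows "t\<^sup>2 = - 1 \<or> t\<^sup>2 + t + 2 = 0"
proof -
  let ?K = "Q_adjoin {s}"
  have F': "subfield F ring_of_type_algebra" using F by (simp add: quadratic_extension_def)
  note dec = quadratic_extension_decompose[OF F t]
  obtain B C' where BC': "B \<in> ?K" "C' \<in> ?K" "t\<^sup>2 = B * t + C'"
    using dec[of "t\<^sup>2"] subfield_type_closed[OF F'] t(1) by metis
  define C where "C = - C'"
  have BC: "B \<in> ?K" "C \<in> ?K" "t\<^sup>2 = B * t - C"
    using BC' Q_adjoin_closed(3) by (auto simp: C_def)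
  have "C \<noteq> 0"
  proof
    assume "C = 0"
    then have "t * (t - B) = 0" using BC(3) by (simp add: power2_eq_square algebra_simps)
    then show False using t(2) BC(1) Q_adjoin_closed(1)[of "{s}"] by auto
  qed
  obtain m1 m0 where m: "m1 \<in> ?K" "m0 \<in> ?K" "w = m1 * t + m0"
    using dec[OF w(1)] by metis
  obtain n1 n0 where n: "n1 \<in> ?K" "n0 \<in> ?K" "v = n1 * t + n0"
    using dec[OF v(1)] by metis
  have "(m1 * t + m0)\<^sup>2 = 2 * t + 2 * t ^ 3"
    using w(2) by (simp add: m(3) power2_eq_square power3_eq_cube algebra_simps)
  then obtain e where "e \<in> ?K" and e: "m1\<^sup>2 = 2 * (B + e)" "m0\<^sup>2 = 2 * C * e"
      "2 * m1 * m0 = 2 - 2 * (C + B * e)" "(m1 * e + m0)\<^sup>2 = 2 * e + 2 * e ^ 3"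
    by (rule quadratic_cubic_chord[OF Q_adjoin_subfield t(2) BC(3,1,2) m(1,2), rotated 3])
      (auto intro: Q_adjoin_closed)
  have "(n1 * t + n0)\<^sup>2 = 2 * t + (- 2) * t ^ 3"
    using v(2) by (simp add: n(3) power2_eq_square power3_eq_cube algebra_simps)
  then obtain f where "f \<in> ?K" and f: "n1\<^sup>2 = - 2 * (B + f)" "n0\<^sup>2 = - 2 * C * f"
      "2 * n1 * n0 = 2 - (- 2) * (C + B * f)" "(n1 * f + n0)\<^sup>2 = 2 * f + (- 2) * f ^ 3"
    by (rule quadratic_cubic_chord[OF Q_adjoin_subfield t(2) BC(3,1,2) n(1,2), rotated 3])
      (auto intro: Q_adjoin_closed)
  have "m1 * e + m0 \<in> ?K" "n1 * f + n0 \<in> ?K"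
    using m n \<open>e \<in> ?K\<close> \<open>f \<in> ?K\<close> by (auto intro!: Q_adjoin_closed)
  then have ecases: "e = 0 \<or> e = 1" and fcases: "f = 0 \<or> f = 1 \<or> f = - 1 \<or> f = - 1 + s \<or> f = - 1 - s"
    using Q_sqrt2_elliptic_plus[OF s \<open>e \<in> ?K\<close>, of "m1 * e + m0"]
      Q_sqrt2_elliptic_minus[OF s \<open>f \<in> ?K\<close>, of "n1 * f + n0"] e(4) f(4)
    by (simp_all add: power2_eq_square power3_eq_cube algebra_simps)
  note ns = Q_sqrt2_nonsquares[OF s]
  from ecases show ?thesis
  proof
    assume "e = 0"
    then have C: "C = 1" using e by simp
    then have n0: "n0\<^sup>2 = - 2 * f" using f by simp
    have "f = - 1"
      using fcases
    proof (elim disjE)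
      assume "f = 0"
      then show ?thesis using f(3) n0 C by simp
    next
      assume "f = 1"
      then show ?thesis using ns(2)[OF n(2)] n0 by simp
    next
      assume f: "f = - 1 + s"
      have "n0\<^sup>2 = 2 - 2 * s" unfolding n0 f by (simp add: algebra_simps)
      then show ?thesis using ns(6)[OF n(2)] by blast
    next
      assume f: "f = - 1 - s"
      have "n0\<^sup>2 = 2 + 2 * s" unfolding n0 f by (simp add: algebra_simps)
      then show ?thesis using ns(5)[OF n(2)] by blast
    qed
    then have "n1 = n0" using f(4) by simp
    then have "B = 0" using f(1) n0 \<open>f = - 1\<close> by simp
    then show ?thesis using BC(3) C by simp
  next
    assume e1: "e = 1"
    then have m0: "m0\<^sup>2 = 2 * C" using e by simp
    then have "m0 \<noteq> 0" using \<open>C \<noteq> 0\<close> by auto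
    \<comment> \<open>The quotient eliminates the still unknown norm \<open>C\<close>, so that
      \<open>- f\<close> must be a square in the base field.\<close>
    then have n0: "(n0 / m0)\<^sup>2 = - f" using f(2) m0 \<open>C \<noteq> 0\<close> by (simp add: power_divide)
    have q: "n0 / m0 \<in> ?K" using m n by (intro Q_adjoin_closed)
    have "f = - 1"
      using fcases
    proof (elim disjE)
      assume f0: "f = 0"
      then have "n0 = 0" using f(2) by simp
      then have "C = - 1" using f(3) f0 by (simp add: add_eq_0_iff)
      then show ?thesis using ns(2)[OF m(2)] m0 by simp
    next
      assume "f = 1"
      then show ?thesis using ns(1)[OF q] n0 by simp
    next
      assume "f = - 1 + s"
      then show ?thesis using ns(4)[OF q] n0 by simp
    next
      assume "f = - 1 - s"
      then show ?thesis using ns(3)[OF q] n0 by simp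
    qed
    then have "n1 = n0" using f(4) by simp
    then have "2 * C = - 2 * (B - 1)" using f(1,2) \<open>f = - 1\<close> by simp
    then have "2 * C = 2 * (1 - B)" by (simp add: algebra_simps)
    then have C: "C = 1 - B" by (simp only: mult_cancel_left) simp
    have "2 * m1 * m0 = 0" using e(3) e1 C by simp
    then have "m1 = 0" using \<open>m0 \<noteq> 0\<close> by simp
    then have "B = - 1" using e(1) e1 by (simp add: add_eq_0_iff2)
    then show ?thesis using BC(3) C by simp
  qed
qed

text \<open>\<open>e\<close> is a rational parameter of the conic \<open>u^2 + T^2 = 1\<close> at
  \<open>T = t^2\<close>, taken from the point \<open>(1, 0)\<close>. Then
  \<open>2 * e * (1 + e^2)\<close> is the square of \<open>2 * e / t\<close>, a point on the curve
  treated above.\<close>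

lemma Q_sqrt2_quartic:
  fixes s :: "'a::field_char_0"
  assumes s: "s\<^sup>2 = 2" and "t \<in> Q_adjoin {s}" "u \<in> Q_adjoin {s}" "u\<^sup>2 = 1 - t ^ 4"
  shows "t = 0 \<or> t\<^sup>2 = 1"
proof (rule ccontr)
  assume t: "\<not> ?thesis"
  define e where "e = (1 - u) / t\<^sup>2"
  have u: "u = 1 - e * t\<^sup>2" using t by (simp add: e_def)
  have "t\<^sup>2 * (2 * e) = t\<^sup>2 * (t\<^sup>2 * (1 + e\<^sup>2))"
    using assms(4) unfolding u by (simp add: power2_eq_square power4_eq_xxxx algebra_simps)
  moreover have "t\<^sup>2 \<noteq> 0" using t by simp
  ultimately have e: "2 * e = t\<^sup>2 * (1 + e\<^sup>2)" using mult_left_cancel by blast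
  then have "(2 * e / t)\<^sup>2 = 2 * e * (1 + e\<^sup>2)"
    using t by (simp add: power_divide power2_eq_square)
  moreover have "e \<in> Q_adjoin {s}" "2 * e / t \<in> Q_adjoin {s}"
    unfolding e_def using assms(2,3) by (auto intro!: Q_adjoin_closed)
  ultimately have "e = 0 \<or> e = 1" using Q_sqrt2_elliptic_plus[OF s] by blast
  then show False using e t by auto
qed

text \<open>If \<open>v\<close> is not in the base field, neither is \<open>w\<close>. Two square
  roots of base field elements generating the same quadratic extension have their product in the
  base field, so \<open>1 - t ^ 4\<close> would be a square there.\<close>

lemma quadratic_parameter_rational:
  fixes F :: "'a::field_char_0 set"
  assumes s: "s\<^sup>2 = 2" and F: "quadratic_extension (Q_adjoin {s}) F"
    and t: "t \<in> Q_adjoin {s}" "t \<noteq> 0" "t\<^sup>2 \<noteq> 1"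
    and w: "w \<in> F" "w\<^sup>2 = 2 * t * (1 + t\<^sup>2)" and v: "v \<in> F" "v\<^sup>2 = 2 * t * (1 - t\<^sup>2)"
  shows "t = - 1 + s \<or> t = - 1 - s"
proof (cases "v \<in> Q_adjoin {s}")
  case True
  then show ?thesis using Q_sqrt2_elliptic_minus[OF s t(1) True v(2)] t by auto
next
  case False
  let ?K = "Q_adjoin {s}"
  have "w \<notin> ?K" using Q_sqrt2_elliptic_plus[OF s t(1) _ w(2)] t by auto
  then obtain a b where ab: "a \<in> ?K" "b \<in> ?K" "v = a * w + b"
    using quadratic_extension_decompose[OF F w(1) _ v(1)] by metis
  have w2: "w\<^sup>2 \<in> ?K" unfolding w(2) using t by (intro Q_adjoin_closed)
  have v2: "v\<^sup>2 \<in> ?K" unfolding v(2) using t by (intro Q_adjoin_closed)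
  have "(2 * a * b) * w + (a\<^sup>2 * w\<^sup>2 + b\<^sup>2) = 0 * w + v\<^sup>2"
    by (simp add: ab(3) power2_eq_square algebra_simps)
  then have "2 * a * b = 0"
    using linear_independent_outside_subfield[OF Q_adjoin_subfield \<open>w \<notin> ?K\<close>, of "2 * a * b" "a\<^sup>2 * w\<^sup>2 + b\<^sup>2" 0 "v\<^sup>2"]
      ab w2 v2 by (auto intro!: Q_adjoin_closed)
  \<comment> \<open>The alternative \<open>a = 0\<close> would put \<open>v\<close> into the base
    field.\<close>
  then have "b = 0" using False ab by auto
  define u where "u = a * w\<^sup>2 / (2 * t)"
  have "2 * t \<in> ?K" using t(1) by (intro Q_adjoin_closed)
  then have "u \<in> ?K"
    unfolding u_def by (intro Q_adjoin_closed(8)[OF Q_adjoin_closed(6)[OF ab(1) w2]])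
  have "u = v * w / (2 * t)" using ab(3) \<open>b = 0\<close> by (simp add: u_def power2_eq_square)
  then have "u\<^sup>2 = v\<^sup>2 * w\<^sup>2 / (2 * t)\<^sup>2" by (simp add: power_divide power_mult_distrib)
  moreover have "v\<^sup>2 * w\<^sup>2 = (1 - t ^ 4) * (2 * t)\<^sup>2"
    unfolding v(2) w(2) by (simp add: power2_eq_square power4_eq_xxxx algebra_simps)
  ultimately have "u\<^sup>2 = 1 - t ^ 4" using t(2) by simp
  then show ?thesis using Q_sqrt2_quartic[OF s t(1) \<open>u \<in> ?K\<close>] t by blast
qed

section \<open>Rescaling of projective points and the points with a vanishing coordinate\<close>

lemma proj_point_scale:
  fixes c :: "'a::field"
  assumes "c \<noteq> 0"
  shows "proj_point (x / c) (y / c) (z / c) = proj_point x y z"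
proof -
  have "\<exists>d. k * x / c = d * x \<and> k * y / c = d * y \<and> k * z / c = d * z \<and> d \<noteq> 0" if "k \<noteq> 0" for k
    using that assms by (intro exI[of _ "k / c"]) simp
  moreover have "\<exists>d. k * x = d * x / c \<and> k * y = d * y / c \<and> k * z = d * z / c \<and> d \<noteq> 0" if "k \<noteq> 0" for k
    using that assms by (intro exI[of _ "k * c"]) simp
  ultimately show ?thesis unfolding proj_point_def by auto
qed

lemma fermat_quartic_pointsI:
  fixes x y z :: "'a::field"
  assumes "x ^ 4 + y ^ 4 = z ^ 4" "c \<noteq> 0" "(x, y, z) \<noteq> (0, 0, 0)" "x / c \<in> K" "y / c \<in> K" "z / c \<in> K"
  shows "proj_point x y z \<in> fermat_quartic_points K"
proof -
  have "(x / c) ^ 4 + (y / c) ^ 4 = (z / c) ^ 4"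
    by (simp add: power_divide flip: assms(1) add_divide_distrib)
  moreover have "(x / c, y / c, z / c) \<noteq> (0, 0, 0)" using assms by simp
  ultimately show ?thesis
    unfolding fermat_quartic_points_def using assms proj_point_scale[OF assms(2), of x y z, symmetric]
    by blast
qed

lemma fourth_root_of_1_cases:
  fixes x i :: "'a::field"
  assumes "x ^ 4 = 1" "i\<^sup>2 = - 1"
  shows "x = 1 \<or> x = - 1 \<or> x = i \<or> x = - i"
proof -
  have "(x - 1) * (x + 1) * (x - i) * (x + i) = (x\<^sup>2 - 1) * (x\<^sup>2 - i\<^sup>2)"
    by (simp add: algebra_simps power2_eq_square)
  also have "\<dots> = 0" using assms(1) by (simp add: assms(2) algebra_simps flip: power_add)
  finally show ?thesis by (auto simp: eq_neg_iff_add_eq_0)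
qed

lemma fourth_root_of_1_mem:
  fixes s i :: "'a::field_char_0"
  assumes "i\<^sup>2 = - 1" "x ^ 4 = 1"
  shows "x \<in> Q_adjoin {s, i}"
  using fourth_root_of_1_cases[OF assms(2,1)] Q_adjoin_incl[of i "{s, i}"]
  by (auto intro!: Q_adjoin_closed)

text \<open>When one coordinate vanishes, the quotient of the other two is a fourth root of 1 or of
  -1.\<close>

lemma fermat_quartic_trivial_points:
  fixes s i :: "'a::field_char_0"
  assumes s: "s\<^sup>2 = 2" and i: "i\<^sup>2 = - 1"
    and eq: "x ^ 4 + y ^ 4 = z ^ 4" "(x, y, z) \<noteq> (0, 0, 0)" "x = 0 \<or> y = 0 \<or> z = 0"
  shows "proj_point x y z \<in> fermat_quartic_points (Q_adjoin {s, i})"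
proof -
  note mem = fourth_root_of_1_mem[OF i, of _ s]
  have si: "s \<in> Q_adjoin {s, i}" "i \<in> Q_adjoin {s, i}" by (simp_all add: Q_adjoin_incl)
  note [intro] = Q_adjoin_closed(1)[of "{s, i}"] Q_adjoin_closed(2)[of "{s, i}"]
  have "z \<noteq> 0" if "x = 0 \<or> y = 0" using eq(1,2) that by auto
  moreover have "y \<noteq> 0" if "z = 0" using eq(1,2) that by auto
  ultimately consider "x = 0" "z \<noteq> 0" | "y = 0" "z \<noteq> 0" | "z = 0" "y \<noteq> 0"
    using eq(3) by blast
  then show ?thesis
  proof cases
    case 1
    then have "y / z \<in> Q_adjoin {s, i}" using eq(1) by (intro mem) (simp add: power_divide)
    then show ?thesis using 1 by (intro fermat_quartic_pointsI[OF eq(1) _ eq(2), of z]) auto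
  next
    case 2
    then have "x / z \<in> Q_adjoin {s, i}" using eq(1) by (intro mem) (simp add: power_divide)
    then show ?thesis using 2 by (intro fermat_quartic_pointsI[OF eq(1) _ eq(2), of z]) auto
  next
    case 3
    \<comment> \<open>A primitive eighth root of unity; dividing by it turns a fourth root of -1
      into a fourth root of 1.\<close>
    define \<zeta> where "\<zeta> = (1 + i) / s"
    have "s \<noteq> 0" using s by auto
    have "\<zeta>\<^sup>2 = (1 + i)\<^sup>2 / 2" by (simp add: \<zeta>_def power_divide s)
    also have "(1 + i)\<^sup>2 = 2 * i" using i by (simp add: power2_eq_square algebra_simps)
    finally have "\<zeta>\<^sup>2 = i" by simp
    then have z4: "\<zeta> ^ 4 = - 1" using i by (metis numeral_Bit0 power2_eq_square power_add)
    have "x ^ 4 = - (y ^ 4)" using eq(1) 3 by (simp add: eq_neg_iff_add_eq_0)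
    then have "(x / y / \<zeta>) ^ 4 = 1" using 3 z4 by (simp add: power_divide power_mult_distrib)
    then have "x / y / \<zeta> \<in> Q_adjoin {s, i}" by (rule mem)
    moreover have "\<zeta> \<in> Q_adjoin {s, i}" unfolding \<zeta>_def using si by (intro Q_adjoin_closed)
    ultimately have "x / y / \<zeta> * \<zeta> \<in> Q_adjoin {s, i}" by (rule Q_adjoin_closed)
    moreover have "\<zeta> \<noteq> 0" using z4 by auto
    ultimately have "x / y \<in> Q_adjoin {s, i}" by simp
    then show ?thesis using 3 by (intro fermat_quartic_pointsI[OF eq(1) _ eq(2), of y]) auto
  qed
qed

theorem theorem5p4:
  fixes F :: "'a::{field_char_0, alg_closed_field} set"
    and sqrt2 imag sqrt_minus7 root4_2 :: 'a
  assumes algebraic_over_Q: "\<And>x::'a. algebraic x"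
    and sqrt2: "sqrt2 ^ 2 = 2"
    and imag: "imag ^ 2 = - 1"
    and sqrt_minus7: "sqrt_minus7 ^ 2 = - 7"
    and root4_2: "root4_2 ^ 4 = 2"
    and F: "quadratic_extension (Q_adjoin {sqrt2}) F"
    and P: "P \<in> fermat_quartic_points F"
  shows "P \<in> fermat_quartic_points (Q_adjoin {sqrt2, imag}) \<or>
         P \<in> fermat_quartic_points (Q_adjoin {sqrt2, sqrt_minus7}) \<or>
         P \<in> fermat_quartic_points (Q_adjoin {root4_2}) \<or>
         P \<in> fermat_quartic_points (Q_adjoin {root4_2 * imag})"
proof -
  obtain x y z where xyz: "x \<in> F" "y \<in> F" "z \<in> F" "(x, y, z) \<noteq> (0, 0, 0)" and eq: "x ^ 4 + y ^ 4 = z ^ 4"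
    and P_eq: "P = proj_point x y z"
    using P by (auto simp: fermat_quartic_points_def)
  show ?thesis
  proof (cases "x = 0 \<or> y = 0 \<or> z = 0")
    case True
    then show ?thesis
      using fermat_quartic_trivial_points[OF sqrt2 imag eq xyz(4)] P_eq by simp
  next
    case False
    have F': "subfield F ring_of_type_algebra" using F by (simp add: quadratic_extension_def)
    note closed = subfield_type_closed[OF F']
    \<comment> \<open>\<open>S\<close> is one factor of
      \<open>y ^ 4 = (z^2 + x^2) * (z^2 - x^2)\<close>; adding or subtracting the other factor
      isolates \<open>z^2\<close> or \<open>x^2\<close>.\<close>
    define S where "S = z\<^sup>2 + x\<^sup>2"
    have SD: "S * (z\<^sup>2 - x\<^sup>2) = y ^ 4"
      using eq by (simp add: S_def algebra_simps flip: power_add)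
    then have "S \<noteq> 0" using False by auto
    have plus: "S\<^sup>2 + y ^ 4 = 2 * z\<^sup>2 * S" and minus: "S\<^sup>2 - y ^ 4 = 2 * x\<^sup>2 * S"
      unfolding SD[symmetric] by (simp_all add: S_def power2_eq_square algebra_simps)
    define t where "t = y\<^sup>2 / S"
    have t2: "t\<^sup>2 = y ^ 4 / S\<^sup>2" by (simp add: t_def power_divide)
    have "1 + t\<^sup>2 = (S\<^sup>2 + y ^ 4) / S\<^sup>2" "1 - t\<^sup>2 = (S\<^sup>2 - y ^ 4) / S\<^sup>2"
      using \<open>S \<noteq> 0\<close> by (simp_all add: t2 add_divide_distrib diff_divide_distrib)
    then have t1p: "1 + t\<^sup>2 = 2 * z\<^sup>2 / S" and t1m: "1 - t\<^sup>2 = 2 * x\<^sup>2 / S"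
      unfolding plus minus using \<open>S \<noteq> 0\<close> by (simp_all add: power2_eq_square)
    have "t \<noteq> 0" "1 + t\<^sup>2 \<noteq> 0" "1 - t\<^sup>2 \<noteq> 0"
      using False \<open>S \<noteq> 0\<close> unfolding t1p t1m by (auto simp: t_def)
    then have tne: "t \<noteq> 0" "t\<^sup>2 \<noteq> - 1" "t\<^sup>2 \<noteq> 1" by auto
    have "S \<in> F" unfolding S_def using xyz by (intro closed)
    then have tF: "t \<in> F" unfolding t_def using xyz by (intro closed)
    have w: "2 * y * z / S \<in> F" "(2 * y * z / S)\<^sup>2 = 2 * t * (1 + t\<^sup>2)"
      subgoal using xyz \<open>S \<in> F\<close> by (intro closed)
      subgoal unfolding t1p by (simp add: t_def power2_eq_square mult_ac)
      done
    have v: "2 * x * y / S \<in> F" "(2 * x * y / S)\<^sup>2 = 2 * t * (1 - t\<^sup>2)"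
      subgoal using xyz \<open>S \<in> F\<close> by (intro closed)
      subgoal unfolding t1m by (simp add: t_def power2_eq_square mult_ac)
      done
    show ?thesis
    proof (cases "t \<in> Q_adjoin {sqrt2}")
      case True
      have "t = - 1 + sqrt2 \<or> t = - 1 - sqrt2"
        by (rule quadratic_parameter_rational[OF sqrt2 F True tne(1,3) w v])
      \<comment> \<open>\<open>\<sigma>\<close> stands for either square root of 2, so both values
        of \<open>t\<close> are handled at once.\<close>
      then obtain \<sigma> where \<sigma>: "t = - 1 + \<sigma>" "\<sigma>\<^sup>2 = 2"
        using sqrt2 by (metis diff_conv_add_uminus power2_minus)
      have tt: "1 - t\<^sup>2 = 2 * t" using \<sigma>(2) unfolding \<sigma>(1) by (simp add: power2_eq_square algebra_simps)
      then have "2 * x\<^sup>2 = 2 * y\<^sup>2" using t1m \<open>S \<noteq> 0\<close> by (simp add: t_def)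
      then have xy: "x\<^sup>2 = y\<^sup>2" by simp
      then have "(y / x)\<^sup>2 = 1" using False by (simp add: power_divide)
      then have yx: "y / x = 1 \<or> y / x = - 1" by (simp add: power2_eq_1_iff)
      have "t * (z\<^sup>2 + x\<^sup>2) = x\<^sup>2" using \<open>S \<noteq> 0\<close> xy by (simp add: t_def S_def)
      then have "t * (z / x)\<^sup>2 = 1 - t" using False by (simp add: power_divide field_simps)
      also have "1 - t = t * \<sigma>" using \<sigma>(2) unfolding \<sigma>(1) by (simp add: power2_eq_square algebra_simps)
      finally have zx: "(z / x)\<^sup>2 = \<sigma>" using tne by simp
      have "(root4_2\<^sup>2)\<^sup>2 = \<sigma>\<^sup>2" using root4_2 \<sigma> by simp
      \<comment> \<open>The sign of \<open>\<sigma>\<close> relative to \<open>root4_2^2\<close>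
        decides between the last two fields, since \<open>imag\<close> absorbs the minus
        sign.\<close>
      then have "\<sigma> = root4_2\<^sup>2 \<or> \<sigma> = - root4_2\<^sup>2" unfolding power2_eq_iff by auto
      then have "(z / x)\<^sup>2 = root4_2\<^sup>2 \<or> (z / x)\<^sup>2 = (root4_2 * imag)\<^sup>2"
        unfolding zx by (simp add: power_mult_distrib imag)
      then obtain r where r: "(z / x)\<^sup>2 = r\<^sup>2" "r = root4_2 \<or> r = root4_2 * imag" by blast
      have "r \<in> Q_adjoin {r}" by (simp add: Q_adjoin_incl)
      moreover have "z / x = r \<or> z / x = - r" using r(1) by (simp only: power2_eq_iff)
      ultimately have "z / x \<in> Q_adjoin {r}" "y / x \<in> Q_adjoin {r}" "x / x \<in> Q_adjoin {r}"
        using yx False Q_adjoin_closed(2,3) by (metis, metis, simp)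
      then have "P \<in> fermat_quartic_points (Q_adjoin {r})"
        unfolding P_eq using False by (intro fermat_quartic_pointsI[OF eq _ xyz(4), of x]) auto
      then show ?thesis using r(2) by auto
    next
      case t_irr: False
      then have t: "t\<^sup>2 + t + 2 = 0"
        using quadratic_parameter_irrational[OF sqrt2 F tF _ w v] tne by blast
      let ?L = "Q_adjoin {sqrt2, sqrt_minus7}"
      \<comment> \<open>Completing the square shows that \<open>t\<close> lies in \<open>?L\<close>;
        as \<open>F\<close> is spanned by \<open>t\<close> and 1 over the base field,
        \<open>F\<close> is then contained in \<open>?L\<close>.\<close>
      have "(2 * t + 1)\<^sup>2 = 4 * (t\<^sup>2 + t + 2) - 7" by (simp add: power2_eq_square algebra_simps)
      also have "\<dots> = sqrt_minus7\<^sup>2" by (simp add: t sqrt_minus7)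
      finally have "2 * t + 1 = sqrt_minus7 \<or> 2 * t + 1 = - sqrt_minus7" by (simp add: power2_eq_iff)
      moreover have "sqrt_minus7 \<in> ?L" by (simp add: Q_adjoin_incl)
      ultimately have "2 * t + 1 \<in> ?L" using Q_adjoin_closed(3) by metis
      then have "(2 * t + 1 - 1) / 2 \<in> ?L"
        by (intro Q_adjoin_closed(8)[OF Q_adjoin_closed(5)] Q_adjoin_closed(2,10))
      then have tL: "t \<in> ?L" by simp
      have KL: "Q_adjoin {sqrt2} \<subseteq> ?L" by (rule Q_adjoin_mono) auto
      have FL: "p \<in> ?L" if "p \<in> F" for p
        using quadratic_extension_decompose[OF F tF t_irr that] KL tL
        by (metis Q_adjoin_closed(4,6) subsetD)
      have "P \<in> fermat_quartic_points ?L"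
        unfolding P_eq fermat_quartic_points_def using xyz eq FL by blast
      then show ?thesis by blast
    qed
  qed
qed

end
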